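(* Let $\mu$ be a Borel probability measure on $\mathbb R$, and let $t>1$. (1) A point $x\in\mathbb R$ satisfies $F_{\mu^{\boxplus t}}(x)=0$ if and only if $x/t$ is an atom of $\mu$ with mass $\mu(\{x/t\})\ge(t-1)/t$. If $\mu(\{x/t\})>(t-1)/t$, then $x$ is an atom of $\mu^{\boxplus t}$, and $$\mu^{\boxplus t}(\{x\})=t\,\mu\left(\left\{\tfrac xt\right\}\right)-(t-1).$$ (2) The nonatomic part of $\mu^{\boxplus t}$ is absolutely continuous (with respect to Lebesgue measure), and its density is continuous except at the (finitely many) points $x$ such that $F_{\mu^{\boxplus t}}(x)=0$. (3) The density of $\mu^{\boxplus t}$ is analytic at all points where it is different from zero.
   Context: $\mathbb C^+=\{z\in\mathbb C:\Im z>0\}$. For a Borel probability measure $\mu$ on $\mathbb R$ let $G_\mu(z)=\int_{\mathbb R}\frac{d\mu(t)}{z-t}$ and $F_\mu=1/G_\mu$ on $\mathbb C^+$. $F_\mu$ has a right inverse $F_\mu^{-1}$ on a domain $\Omega=\bigcup_{\alpha>0}\{z\in\mathbb C^+:\Im z>\beta_\alpha,\ |\Re z|<\alpha\Im z\}$ with $F_\mu^{-1}(z)/z\to1$ as $z\to\infty$ within cones $|\Re z|<\alpha\Im z$; put $\varphi_\mu(z)=F_\mu^{-1}(z)-z$. For $t>1$, $\mu^{\boxplus t}$ denotes the (unique) probability measure on $\mathbb R$ with $\varphi_{\mu^{\boxplus t}}=t\varphi_\mu$ on the common domain; such a measure exists for every $t\ge 1$. There is an analytic $\omega_t:\mathbb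 C^+\to\mathbb C^+$ with $F_{\mu^{\boxplus t}}=F_\mu\circ\omega_t$ and $\omega_t(z)=\frac1tz+(1-\frac1t)F_{\mu^{\boxplus t}}(z)$; $\omega_t$, and hence $F_{\mu^{\boxplus t}}$, extends continuously to $\mathbb C^+\cup\mathbb R$ with finite values, and $F_{\mu^{\boxplus t}}(x)$ for $x\in\mathbb R$ denotes the value of this extension. *)

theory Defs
  imports "HOL-Probability.Probability" "HOL-Complex_Analysis.Complex_Analysis"
begin

definition upper_half_plane :: "complex set" where
  "upper_half_plane = {z. 0 < Im z}"

definition cauchy_transform :: "real measure \<Rightarrow> complex \<Rightarrow> complex" where
  "cauchy_transform M z = (LINT s|M. 1 / (z - complex_of_real s))"

definition F_transform :: "real measure \<Rightarrow> complex \<Rightarrow> complex" where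
  "F_transform M z = 1 / cauchy_transform M z"

definition F_boundary :: "real measure \<Rightarrow> real \<Rightarrow> complex" where
  "F_boundary M x = Lim (at (complex_of_real x) within upper_half_plane) (F_transform M)"

definition cone :: "real \<Rightarrow> complex set" where
  "cone \<alpha> = {z \<in> upper_half_plane. \<bar>Re z\<bar> < \<alpha> * Im z}"

definition inverse_domain :: "(real \<Rightarrow> real) \<Rightarrow> complex set" where
  "inverse_domain \<beta> = (\<Union>\<alpha>\<in>{0<..}. {z \<in> cone \<alpha>. \<beta> \<alpha> < Im z})"

text \<open>
  The function \<open>h\<close> is a branch of the right inverse of the \<open>F\<close>-transform defined near infinity.
  The asymptotics at infinity single out this branch, so \<open>h\<close> is determined by \<open>M\<close> and \<open>\<beta>\<close>
  on the (connected) set \<open>inverse_domain \<beta>\<close>.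
\<close>

definition F_right_inverse ::
    "real measure \<Rightarrow> (real \<Rightarrow> real) \<Rightarrow> (complex \<Rightarrow> complex) \<Rightarrow> bool" where
  "F_right_inverse M \<beta> h \<longleftrightarrow>
     h holomorphic_on inverse_domain \<beta> \<and>
     (\<forall>z\<in>inverse_domain \<beta>. h z \<in> upper_half_plane \<and> F_transform M (h z) = z) \<and>
     (\<forall>\<alpha>>0. ((\<lambda>z. h z / z) \<longlongrightarrow> 1) (inf at_infinity (principal (cone \<alpha>))))"

definition voiculescu_transform ::
    "real measure \<Rightarrow> (real \<Rightarrow> real) \<Rightarrow> (complex \<Rightarrow> complex) \<Rightarrow> bool" where
  "voiculescu_transform M \<beta> \<phi> \<longleftrightarrow>
     (\<exists>h. F_right_inverse M \<beta> h \<and> (\<forall>z\<in>inverse_domain \<beta>. \<phi> z = h z - z))"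

text \<open>
  \<open>N\<close> is the free convolution power of \<open>M\<close> with exponent \<open>t\<close>. Since Voiculescu transforms
  on two domains agree on the (connected) intersection, the choice of the domains is immaterial.
\<close>

definition free_convolution_power :: "real measure \<Rightarrow> real \<Rightarrow> real measure \<Rightarrow> bool" where
  "free_convolution_power M t N \<longleftrightarrow>
     real_distribution N \<and>
     (\<exists>\<beta> \<phi> \<beta>' \<psi>. voiculescu_transform M \<beta> \<phi> \<and> voiculescu_transform N \<beta>' \<psi> \<and>
        (\<forall>z\<in>inverse_domain \<beta> \<inter> inverse_domain \<beta>'. \<psi> z = complex_of_real t * \<phi> z))"

definition atoms :: "real measure \<Rightarrow> real set" where
  "atoms M = {x. 0 < measure M {x}}"

definition nonatomic_part :: "real measure \<Rightarrow> real measure" where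
  "nonatomic_part M = density M (indicator (- atoms M))"

definition real_analytic_at :: "(real \<Rightarrow> real) \<Rightarrow> real \<Rightarrow> bool" where
  "real_analytic_at f x \<longleftrightarrow>
     (\<exists>a. \<exists>r>0. \<forall>y. \<bar>y - x\<bar> < r \<longrightarrow> (\<lambda>n. a n * (y - x) ^ n) sums f y)"

end

theory Submission imports Defs begin

text \<open>
  Write \<open>c = t - 1\<close>, \<open>D w = F\<^sub>\<mu> w - w\<close> and \<open>H w = w - c D w\<close>. Comparing Voiculescu transforms near
  infinity and continuing analytically, \<open>\<omega> z = (z + c F\<^sub>\<nu> z) / t\<close> satisfies \<open>F\<^sub>\<nu> = F\<^sub>\<mu> \<circ> \<omega>\<close>, that is,
  \<open>H (\<omega> z) = z\<close>. Since \<open>D\<close> maps the upper half plane into its closure, the Schwarz--Pick inequality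
  bounds \<open>\<bar>D w - D v\<bar> / \<bar>w - v\<bar>\<close> by the geometric mean of \<open>Im D / Im\<close> at the two points, and \<open>Im H > 0\<close>
  says that this quotient is less than \<open>1 / c\<close>. Hence \<open>H\<close> is injective on \<open>{Im H > 0}\<close>, \<open>\<omega>\<close> is locally
  bounded up to the real line, and a nondegenerate set of cluster values of \<open>\<omega>\<close> at a real point would
  force \<open>H\<close> to be constant; so \<open>\<omega>\<close> and \<open>F\<^sub>\<nu>\<close> extend continuously. The same inequality at a real
  boundary value, together with \<open>(z - a) G (z) \<rightarrow> \<mu> {a}\<close> nontangentially, gives the atoms. Stieltjes
  inversion yields the density \<open>- Im (1 / F\<^sub>\<nu>) / \<pi>\<close>, and where it is positive \<open>\<omega>\<close> has a boundary value in
  the open half plane at which \<open>H\<close> is locally invertible.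
\<close>

section \<open>Self-maps of the upper half plane\<close>

lemma open_upper_half_plane: "open upper_half_plane"
  unfolding upper_half_plane_def by (rule open_halfspace_Im_gt)

lemma convex_upper_half_plane: "convex upper_half_plane"
  unfolding upper_half_plane_def by (rule convex_halfspace_Im_gt)

lemma connected_upper_half_plane: "connected upper_half_plane"
  by (rule convex_connected[OF convex_upper_half_plane])

text \<open>The square of the denominator of the pseudohyperbolic distance
  \<open>cmod (a - b) / cmod (a - cnj b)\<close>. It shows that this quotient is below 1 in the half
  plane and turns the Schwarz-Pick inequality into one about imaginary parts.\<close>

lemma cmod_diff_cnj_sq: "(cmod (a - cnj b))\<^sup>2 = (cmod (a - b))\<^sup>2 + 4 * Im a * Im b"
  unfolding cmod_power2 by (simp add: power2_eq_square algebra_simps)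

text \<open>The image of a nonconstant \<open>f\<close> is open by the open mapping theorem, and an
  open subset of the closed half plane lies in its interior.\<close>

lemma holomorphic_Im_nonneg_cases:
  assumes hol: "f holomorphic_on S" and S: "open S" "connected S"
    and nn: "\<And>w. w \<in> S \<Longrightarrow> 0 \<le> Im (f w)"
  shows "f constant_on S \<or> (\<forall>w\<in>S. 0 < Im (f w))"
proof (cases "f constant_on S")
  case False
  have "open (f ` S)"
    by (rule open_mapping_thm[OF hol S S(1) order.refl False])
  moreover have "f ` S \<subseteq> {z. Im z \<ge> 0}" using nn by auto
  ultimately have "f ` S \<subseteq> interior {z. Im z \<ge> 0}" by (simp add: interior_maximal)
  moreover have "interior {z. Im z \<ge> 0} = {z. Im z > 0}"
    using interior_halfspace_ge[of \<i> 0] by (simp add: inner_complex_def)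
  ultimately show ?thesis by auto
qed simp

text \<open>The Schwarz lemma transported to the half plane, with all denominators cleared. In this
  form real constants are covered too, and the two ratios \<open>Im f / Im\<close> can be estimated
  one at a time.\<close>

lemma Schwarz_Pick_upper_half_plane:
  assumes hol: "f holomorphic_on upper_half_plane"
    and nn: "\<And>w. w \<in> upper_half_plane \<Longrightarrow> 0 \<le> Im (f w)"
    and z: "z \<in> upper_half_plane" and w: "w \<in> upper_half_plane"
  shows "Im z * Im w * (cmod (f z - f w))\<^sup>2 \<le> (cmod (z - w))\<^sup>2 * (Im (f z) * Im (f w))"
  using holomorphic_Im_nonneg_cases[OF hol open_upper_half_plane connected_upper_half_plane nn]
proof
  assume "f constant_on upper_half_plane"
  then have "f z = f w" using z w by (auto simp: constant_on_def)
  then show ?thesis using nn[OF w] by simp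
next
  assume pos: "\<forall>w\<in>upper_half_plane. 0 < Im (f w)"
  have Iz: "Im z > 0" and Iw: "Im w > 0" using z w by (auto simp: upper_half_plane_def)
  have ne: "a - cnj b \<noteq> 0" if "0 < Im a" "0 < Im b" for a b
    using that by (auto simp: complex_eq_iff)
  \<comment> \<open>Cayley maps carrying \<open>0\<close> to \<open>w\<close> and \<open>f w\<close> to \<open>0\<close>, so that the Schwarz lemma applies to \<open>\<psi> \<circ> f \<circ> \<phi>\<close>\<close>
  define \<phi> where "\<phi> \<zeta> = (w - cnj w * \<zeta>) / (1 - \<zeta>)" for \<zeta>
  define \<psi> where "\<psi> v = (v - f w) / (v - cnj (f w))" for v
  have \<phi>U: "\<phi> \<zeta> \<in> upper_half_plane" if "cmod \<zeta> < 1" for \<zeta>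
  proof -
    have n1: "1 - \<zeta> \<noteq> 0" using that by auto
    have "\<phi> \<zeta> = (w - cnj w * \<zeta>) * cnj (1 - \<zeta>) / (complex_of_real ((cmod (1 - \<zeta>))\<^sup>2))"
      unfolding \<phi>_def complex_norm_square using n1 by simp
    then have "Im (\<phi> \<zeta>) = Im ((w - cnj w * \<zeta>) * cnj (1 - \<zeta>)) / (cmod (1 - \<zeta>))\<^sup>2"
      by (simp only: Im_divide_of_real)
    also have "Im ((w - cnj w * \<zeta>) * cnj (1 - \<zeta>)) = Im w * (1 - (cmod \<zeta>)\<^sup>2)"
      unfolding cmod_power2 by (simp add: power2_eq_square algebra_simps)
    finally have "Im (\<phi> \<zeta>) = Im w * (1 - (cmod \<zeta>)\<^sup>2) / (cmod (1 - \<zeta>))\<^sup>2" .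
    moreover have "(cmod \<zeta>)\<^sup>2 < 1" using that by (simp add: power_less_one_iff abs_square_less_1)
    ultimately show ?thesis using Iw n1 by (simp add: upper_half_plane_def)
  qed
  have quot: "cmod ((a - b) / (a - cnj b)) < 1" if ab: "0 < Im a" "0 < Im b" for a b
  proof -
    have "(cmod (a - b))\<^sup>2 < (cmod (a - cnj b))\<^sup>2"
      using ab by (simp add: cmod_diff_cnj_sq)
    then have "cmod (a - b) < cmod (a - cnj b)" by (rule power2_less_imp_less) simp
    then show ?thesis using ne[OF ab] by (simp add: norm_divide)
  qed
  have hol\<phi>: "\<phi> holomorphic_on ball 0 1"
    unfolding \<phi>_def by (intro holomorphic_intros) auto
  have "f holomorphic_on \<phi> ` ball 0 1"
    by (rule holomorphic_on_subset[OF hol]) (auto intro: \<phi>U)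
  then have holf\<phi>: "(\<lambda>\<zeta>. f (\<phi> \<zeta>)) holomorphic_on ball 0 1"
    using holomorphic_on_compose[OF hol\<phi>] by (simp add: o_def)
  have fw: "0 < Im (f w)" using pos w by auto
  have hol2: "(\<lambda>\<zeta>. \<psi> (f (\<phi> \<zeta>))) holomorphic_on ball 0 1"
    unfolding \<psi>_def using ne[OF _ fw] pos \<phi>U
    by (intro holomorphic_intros holf\<phi>) auto
  have l: "norm (\<psi> (f (\<phi> \<zeta>))) < 1" if "norm \<zeta> < 1" for \<zeta>
    unfolding \<psi>_def using quot[OF _ fw] pos \<phi>U[OF that] by auto
  \<comment> \<open>The preimage of \<open>z\<close> under \<open>\<phi>\<close>, obtained by
    inverting the Cayley map.\<close>
  define \<zeta> where "\<zeta> = (z - w) / (z - cnj w)"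
  have n\<zeta>: "norm \<zeta> < 1" unfolding \<zeta>_def by (rule quot[OF Iz Iw])
  have S: "norm (\<psi> (f (\<phi> \<zeta>))) \<le> norm \<zeta>"
    by (rule Schwarz_Lemma(1)[OF hol2 _ l n\<zeta>]) (auto simp: \<phi>_def \<psi>_def)
  have n0: "z - cnj w \<noteq> 0" "w - cnj w \<noteq> 0" using ne Iz Iw by auto
  have "\<phi> \<zeta> = z"
  proof -
    have e1: "1 - \<zeta> = (w - cnj w) / (z - cnj w)"
      unfolding \<zeta>_def using n0 by (simp add: field_simps)
    have e2: "w - cnj w * \<zeta> = z * (w - cnj w) / (z - cnj w)"
      unfolding \<zeta>_def using n0 by (simp add: field_simps)
    show ?thesis unfolding \<phi>_def e1 e2 using n0 by simp
  qed
  with S have "cmod (f z - f w) / cmod (f z - cnj (f w)) \<le> cmod (z - w) / cmod (z - cnj w)"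
    by (simp add: \<psi>_def \<zeta>_def norm_divide)
  moreover have "0 < cmod (z - cnj w)" "0 < cmod (f z - cnj (f w))"
    using n0 ne[OF _ fw] pos z by auto
  ultimately have "cmod (f z - f w) * cmod (z - cnj w) \<le> cmod (z - w) * cmod (f z - cnj (f w))"
    by (simp add: field_simps)
  then have "(cmod (f z - f w) * cmod (z - cnj w))\<^sup>2 \<le> (cmod (z - w) * cmod (f z - cnj (f w)))\<^sup>2"
    by (rule power_mono) simp
  \<comment> \<open>After expansion both sides contain
    \<open>(cmod (f z - f w))\<^sup>2 * (cmod (z - w))\<^sup>2\<close>; cancelling it leaves the
    claim up to a common factor 4.\<close>
  then show ?thesis
    unfolding power_mult_distrib cmod_diff_cnj_sq by (simp add: algebra_simps)
qed

section \<open>Boundary behaviour of the subordination function\<close>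

text \<open>An abstract setting for the boundary argument, instantiated later with
  \<open>D w = F_transform \<mu> w - w\<close> and \<open>c = t - 1\<close>. The last assumption
  says that \<open>\<omega> z\<close> is a fixed point of the map sending \<open>w\<close> to
  \<open>z + c * D w\<close>.\<close>

locale subordination =
  fixes D \<omega> :: "complex \<Rightarrow> complex" and c :: real
  assumes holo: "D holomorphic_on upper_half_plane"
    and nonneg: "w \<in> upper_half_plane \<Longrightarrow> 0 \<le> Im (D w)"
    and c_pos: "0 < c"
    and cont: "continuous_on upper_half_plane \<omega>"
    and in_uhp: "z \<in> upper_half_plane \<Longrightarrow> \<omega> z \<in> upper_half_plane"
    and eq: "z \<in> upper_half_plane \<Longrightarrow> \<omega> z - c * D (\<omega> z) = z"
begin

section \<open>The map \<open>H\<close>, its injectivity, and local boundedness of its right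
  inverse\<close>

definition H :: "complex \<Rightarrow> complex" where "H w = w - c * D w"

lemma H_holo: "H holomorphic_on upper_half_plane"
  unfolding H_def by (intro holomorphic_intros holo)

lemma H_\<omega>: "z \<in> upper_half_plane \<Longrightarrow> H (\<omega> z) = z"
  using eq by (simp add: H_def)

lemma Im_H: "Im (H w) = Im w - c * Im (D w)"
  by (simp add: H_def)

lemma i_uhp: "\<i> \<in> upper_half_plane"
  by (simp add: upper_half_plane_def)

text \<open>The constant is distributed so that each imaginary part appears as
  \<open>c * Im (D w)\<close>, the quantity that positivity of \<open>Im (H w)\<close> bounds by
  \<open>Im w\<close>.\<close>

lemma scaled_pick:
  assumes "w \<in> upper_half_plane" "v \<in> upper_half_plane" 
  shows "Im w * Im v * (c * cmod (D w - D v))\<^sup>2 \<le> (cmod (w - v))\<^sup>2 * ((c * Im (D w)) * (c * Im (D v)))"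
  using mult_left_mono[OF Schwarz_Pick_upper_half_plane[OF holo nonneg assms], of "c\<^sup>2"] c_pos
  by (simp add: power_mult_distrib power2_eq_square mult_ac)

text \<open>Equal values would force \<open>c * cmod (D w - D v) = cmod (w - v)\<close>, while
  Schwarz-Pick together with \<open>c * Im (D w) < Im w\<close> at both points makes the left side
  strictly smaller when \<open>w\<close> and \<open>v\<close> differ.\<close>

lemma H_inj:
  assumes w: "w \<in> upper_half_plane" "v \<in> upper_half_plane" 
    and pos: "0 < Im (H w)" "0 < Im (H v)" and eq: "H w = H v"
  shows "w = v"
proof (rule ccontr)
  assume ne: "w \<noteq> v"
  have "c * cmod (D w - D v) = cmod (w - v)"
  proof -
    have "w - v = c * (D w - D v)" using eq by (simp add: H_def algebra_simps)
    then show ?thesis using c_pos by (simp add: norm_mult)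
  qed
  with scaled_pick[OF w] have "Im w * Im v * (cmod (w - v))\<^sup>2 \<le> (cmod (w - v))\<^sup>2 * ((c * Im (D w)) * (c * Im (D v)))"
    by simp
  moreover have "0 < (cmod (w - v))\<^sup>2" using ne by simp
  ultimately have "Im w * Im v \<le> (c * Im (D w)) * (c * Im (D v))"
    by (simp add: mult.commute)
  moreover have "(c * Im (D w)) * (c * Im (D v)) < Im w * Im v"
    using pos c_pos nonneg[OF w(1)] nonneg[OF w(2)] by (intro mult_strict_mono') (auto simp: Im_H)
  ultimately show False by simp
qed

text \<open>Both \<open>\<omega> (H w)\<close> and \<open>w\<close> are sent to \<open>H w\<close>,
  so injectivity identifies them. Hence \<open>\<omega>\<close> maps the half plane onto the part of
  it where \<open>Im H\<close> is positive.\<close>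

lemma \<omega>_H: "w \<in> upper_half_plane \<Longrightarrow> 0 < Im (H w) \<Longrightarrow> \<omega> (H w) = w"
  using H_inj[of "\<omega> (H w)" w] in_uhp[of "H w"] H_\<omega>[of "H w"] by (simp add: upper_half_plane_def)

lemma c_Im_D_less: "z \<in> upper_half_plane \<Longrightarrow> c * Im (D (\<omega> z)) < Im (\<omega> z)"
  using H_\<omega>[of z] Im_H[of "\<omega> z"] by (simp add: upper_half_plane_def)

text \<open>Relative to the fixed point \<open>v = \<omega> \<i>\<close>, Schwarz-Pick gives
  \<open>c * D\<close> the Lipschitz ratio \<open>q < 1\<close> at every value of
  \<open>\<omega>\<close>. Subtracting the fixed point equations at \<open>z\<close> and
  \<open>\<i>\<close> then bounds \<open>(1 - q) * cmod (\<omega> z - v)\<close> by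
  \<open>cmod (z - \<i>)\<close>.\<close>

lemma \<omega>_bounded: "\<exists>B. \<forall>z\<in>upper_half_plane \<inter> ball p 1. cmod (\<omega> z) \<le> B"
proof -
  define v where "v = \<omega> \<i>"
  have v: "v \<in> upper_half_plane" unfolding v_def by (rule in_uhp[OF i_uhp])
  have Hv: "Im v - c * Im (D v) = 1" using H_\<omega>[OF i_uhp] Im_H[of v] by (simp add: v_def)
  have Iv: "0 < Im v" using v by (simp add: upper_half_plane_def)
  \<comment> \<open>Of the two factors in the geometric mean, the one at \<open>\<omega> z\<close>
    is at most 1 by \<open>c_Im_D_less\<close>. The one at \<open>v\<close> equals
    \<open>1 - 1 / Im v\<close> by \<open>Hv\<close>, and \<open>q\<close> is its square
    root.\<close>
  define q where "q = sqrt (c * Im (D v) / Im v)"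
  have q0: "0 \<le> c * Im (D v) / Im v" using c_pos nonneg[OF v] Iv by simp
  have q: "q < 1" "0 \<le> q" using q0 Hv Iv unfolding q_def by (auto simp: real_sqrt_lt_1_iff)
  have "cmod (\<omega> z) \<le> cmod v + (cmod p + 2) / (1 - q)" if z: "z \<in> upper_half_plane \<inter> ball p 1" for z
  proof -
    define w where "w = \<omega> z"
    have zU: "z \<in> upper_half_plane" using z by simp
    have w: "w \<in> upper_half_plane" unfolding w_def by (rule in_uhp[OF zU])
    have Iw: "0 < Im w" using w by (simp add: upper_half_plane_def)
    have "Im w * Im v * (c * cmod (D w - D v))\<^sup>2 \<le> (cmod (w - v))\<^sup>2 * ((c * Im (D w)) * (c * Im (D v)))"
      by (rule scaled_pick[OF w v])
    also have "\<dots> \<le> (cmod (w - v))\<^sup>2 * (Im w * (c * Im (D v)))"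
      using c_Im_D_less[OF zU] c_pos nonneg[OF v] unfolding w_def
      by (intro mult_left_mono mult_right_mono) auto
    finally have "Im w * (Im v * (c * cmod (D w - D v))\<^sup>2) \<le> Im w * ((cmod (w - v))\<^sup>2 * (c * Im (D v)))"
      by (simp add: mult_ac)
    then have "Im v * (c * cmod (D w - D v))\<^sup>2 \<le> (cmod (w - v))\<^sup>2 * (c * Im (D v))"
      using Iw by simp
    then have "(c * cmod (D w - D v))\<^sup>2 \<le> (cmod (w - v))\<^sup>2 * (c * Im (D v) / Im v)"
      using Iv by (simp add: field_simps)
    also have "\<dots> = (q * cmod (w - v))\<^sup>2"
      using q0 by (simp add: q_def power_mult_distrib)
    finally have *: "c * cmod (D w - D v) \<le> q * cmod (w - v)"
      by (rule power2_le_imp_le) (use q in simp)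
    have "z - \<i> = (w - v) - c * (D w - D v)"
      using H_\<omega>[OF zU] H_\<omega>[OF i_uhp] by (simp add: H_def w_def v_def algebra_simps)
    then have "cmod (w - v) - cmod (c * (D w - D v)) \<le> cmod (z - \<i>)"
      by (metis norm_triangle_ineq2)
    with * have "(1 - q) * cmod (w - v) \<le> cmod (z - \<i>)"
      using c_pos by (simp only: norm_mult norm_of_real abs_of_pos) (simp add: left_diff_distrib)
    also have "cmod (z - \<i>) \<le> cmod z + 1" using norm_triangle_ineq4[of z \<i>] by simp
    also have "cmod z \<le> cmod p + 1"
      using z norm_triangle_ineq2[of z p] by (simp add: dist_norm norm_minus_commute)
    finally have "cmod (w - v) \<le> (cmod p + 2) / (1 - q)" using q by (simp add: field_simps)
    then show ?thesis using norm_triangle_ineq2[of w v] by (simp add: w_def)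
  qed
  then show ?thesis by blast
qed

section \<open>Cluster values of \<omega> at a real point, along arbitrary sequences in the half
  plane\<close>

definition cluster :: "real \<Rightarrow> complex \<Rightarrow> bool" where
  "cluster x l \<longleftrightarrow> (\<exists>z. (\<forall>n::nat. z n \<in> upper_half_plane) \<and> z \<longlonglongrightarrow> of_real x \<and> (\<lambda>n. \<omega> (z n)) \<longlonglongrightarrow> l)"

lemma cluster_Im_nonneg:
  assumes "cluster x l" shows "0 \<le> Im l"
proof -
  obtain z where z: "\<And>n::nat. z n \<in> upper_half_plane" "(\<lambda>n. \<omega> (z n)) \<longlonglongrightarrow> l"
    using assms by (auto simp: cluster_def)
  have "(\<lambda>n. Im (\<omega> (z n))) \<longlonglongrightarrow> Im l" using z(2) by (intro tendsto_intros)
  moreover have "0 \<le> Im (\<omega> (z n))" for n using in_uhp[OF z(1)[of n]] by (simp add: upper_half_plane_def)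
  ultimately show ?thesis by (intro LIMSEQ_le_const) auto
qed

lemma bounded_seq_has_cluster:
  assumes z: "\<And>n::nat. z n \<in> upper_half_plane" "z \<longlonglongrightarrow> of_real x"
  obtains l r where "strict_mono (r :: nat \<Rightarrow> nat)" "(\<lambda>n. \<omega> (z (r n))) \<longlonglongrightarrow> l" "cluster x l"
proof -
  obtain B where B: "\<And>z. z \<in> upper_half_plane \<Longrightarrow> z \<in> ball (of_real x) 1 \<Longrightarrow> cmod (\<omega> z) \<le> B"
    using \<omega>_bounded[of "of_real x"] by (metis IntI)
  have "eventually (\<lambda>n. z n \<in> ball (of_real x) 1) sequentially"
    using z(2) by (rule topological_tendstoD) auto
  then obtain N where N: "\<And>n. n \<ge> N \<Longrightarrow> z n \<in> ball (of_real x) 1"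
    by (auto simp: eventually_sequentially)
  define u where "u n = \<omega> (z (n + N))" for n
  have "\<forall>n. u n \<in> cball 0 B" using B[OF z(1) N] by (auto simp: u_def)
  then obtain l r where r: "strict_mono r" "(u \<circ> r) \<longlonglongrightarrow> l"
    using compact_imp_seq_compact[OF compact_cball, of 0 B] unfolding seq_compact_def by metis
  \<comment> \<open>The bound holds only from index \<open>N\<close> on, so the subsequence is
    chosen in the shifted sequence and shifted back.\<close>
  define r' where "r' n = r n + N" for n
  have m: "strict_mono r'" using r(1) by (auto simp: r'_def strict_mono_def)
  have l: "(\<lambda>n. \<omega> (z (r' n))) \<longlonglongrightarrow> l" using r(2) by (simp add: u_def r'_def o_def)
  have "(z \<circ> r') \<longlonglongrightarrow> of_real x" by (rule LIMSEQ_subseq_LIMSEQ[OF z(2) m])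
  then have "cluster x l"
    unfolding cluster_def using l z(1) by (intro exI[of _ "z \<circ> r'"]) (auto simp: o_def)
  with m l show ?thesis by (rule that)
qed

text \<open>A real-valued form of the connectedness of the cluster set: the intermediate value
  theorem on the segment joining \<open>y n\<close> to \<open>z n\<close> yields points where
  \<open>p \<circ> \<omega>\<close> equals \<open>k\<close>, and these points still tend to
  \<open>x\<close>. It is used with \<open>p\<close> a distance and with
  \<open>p = Re\<close>.\<close>

lemma cluster_intermediate:
  assumes "cluster x a" "cluster x b" and p: "continuous_on UNIV (p :: complex \<Rightarrow> real)"
    and k: "p a < k" "k < p b"
  obtains l where "cluster x l" "p l = k"
proof -
  obtain y where y: "\<And>n::nat. y n \<in> upper_half_plane" "y \<longlonglongrightarrow> of_real x" "(\<lambda>n. \<omega> (y n)) \<longlonglongrightarrow> a"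
    using assms(1) by (auto simp: cluster_def)
  obtain z where z: "\<And>n::nat. z n \<in> upper_half_plane" "z \<longlonglongrightarrow> of_real x" "(\<lambda>n. \<omega> (z n)) \<longlonglongrightarrow> b"
    using assms(2) by (auto simp: cluster_def)
  have pc: "isCont p w" for w using p by (simp add: continuous_on_eq_continuous_at)
  have "(\<lambda>n. p (\<omega> (y n))) \<longlonglongrightarrow> p a" "(\<lambda>n. p (\<omega> (z n))) \<longlonglongrightarrow> p b"
    using isCont_tendsto_compose[OF pc y(3)] isCont_tendsto_compose[OF pc z(3)] by auto
  then have "eventually (\<lambda>n. p (\<omega> (y n)) < k \<and> k < p (\<omega> (z n))) sequentially"
    using k by (intro eventually_conj order_tendstoD)
  then obtain N where N: "\<And>n. n \<ge> N \<Longrightarrow> p (\<omega> (y n)) < k \<and> k < p (\<omega> (z n))"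
    by (auto simp: eventually_sequentially)
  have "\<exists>\<zeta>\<in>closed_segment (y (n + N)) (z (n + N)). p (\<omega> \<zeta>) = k" for n
  proof -
    let ?S = "closed_segment (y (n + N)) (z (n + N))"
    have S: "?S \<subseteq> upper_half_plane"
      by (rule closed_segment_subset[OF y(1) z(1) convex_upper_half_plane])
    have "continuous_on ?S (\<lambda>\<zeta>. p (\<omega> \<zeta>))"
      by (rule continuous_on_compose2[OF p continuous_on_subset[OF cont S]]) auto
    then have "connected ((\<lambda>\<zeta>. p (\<omega> \<zeta>)) ` ?S)"
      by (rule connected_continuous_image) auto
    then have "{p (\<omega> (y (n + N)))..p (\<omega> (z (n + N)))} \<subseteq> (\<lambda>\<zeta>. p (\<omega> \<zeta>)) ` ?S"
      by (rule connected_contains_Icc) auto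
    moreover have "k \<in> {p (\<omega> (y (n + N)))..p (\<omega> (z (n + N)))}" using N[of "n + N"] by auto
    ultimately have "k \<in> (\<lambda>\<zeta>. p (\<omega> \<zeta>)) ` ?S" by (rule subsetD)
    then show ?thesis by auto
  qed
  then obtain \<zeta> where \<zeta>: "\<And>n. \<zeta> n \<in> closed_segment (y (n + N)) (z (n + N))" "\<And>n. p (\<omega> (\<zeta> n)) = k"
    by metis
  have \<zeta>U: "\<zeta> n \<in> upper_half_plane" for n
    using closed_segment_subset[OF y(1) z(1) convex_upper_half_plane] \<zeta>(1) by blast
  \<comment> \<open>Balls are convex, so the segment stays in the ball about \<open>x\<close> whose
    radius is the sum of the distances of its endpoints from \<open>x\<close>.\<close>
  have "\<zeta> \<longlonglongrightarrow> of_real x"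
  proof (rule metric_tendsto_imp_tendsto)
    show "(\<lambda>n. dist (y (n + N)) (of_real x) + dist (z (n + N)) (of_real x)) \<longlonglongrightarrow> 0"
      using tendsto_add[OF tendsto_dist[OF LIMSEQ_ignore_initial_segment[OF y(2), of N] tendsto_const[of "of_real x"]]
          tendsto_dist[OF LIMSEQ_ignore_initial_segment[OF z(2), of N] tendsto_const[of "of_real x"]]] by simp
    show "eventually (\<lambda>n. dist (\<zeta> n) (of_real x) \<le> dist (dist (y (n + N)) (of_real x) + dist (z (n + N)) (of_real x)) 0) sequentially"
    proof (intro always_eventually allI)
      fix n
      have "\<zeta> n \<in> cball (of_real x) (dist (y (n + N)) (of_real x) + dist (z (n + N)) (of_real x))"
        by (rule subsetD[OF closed_segment_subset \<zeta>(1)]) (auto simp: dist_commute)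
      then show "dist (\<zeta> n) (of_real x) \<le> dist (dist (y (n + N)) (of_real x) + dist (z (n + N)) (of_real x)) 0"
        by (auto simp: dist_commute)
    qed
  qed
  then obtain l r where l: "strict_mono r" "(\<lambda>n. \<omega> (\<zeta> (r n))) \<longlonglongrightarrow> l" "cluster x l"
    using bounded_seq_has_cluster[of \<zeta> x] \<zeta>U by blast
  have "(\<lambda>n. p (\<omega> (\<zeta> (r n)))) \<longlonglongrightarrow> p l" using isCont_tendsto_compose[OF pc l(2)] .
  then have "p l = k" by (simp add: \<zeta>(2) LIMSEQ_const_iff)
  with l(3) show ?thesis by (rule that)
qed

lemma cluster_H:
  assumes "cluster x a" "a \<in> upper_half_plane" shows "H a = of_real x"
proof -
  obtain z where z: "\<And>n::nat. z n \<in> upper_half_plane" "z \<longlonglongrightarrow> of_real x" "(\<lambda>n. \<omega> (z n)) \<longlonglongrightarrow> a"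
    using assms(1) by (auto simp: cluster_def)
  have "isCont H a"
    using H_holo holomorphic_on_imp_continuous_on assms(2) open_upper_half_plane continuous_on_eq_continuous_at by blast
  then have "(\<lambda>n. H (\<omega> (z n))) \<longlonglongrightarrow> H a" using z(3) by (rule isCont_tendsto_compose)
  then show ?thesis using z(2) H_\<omega>[OF z(1)] LIMSEQ_unique by fastforce
qed

text \<open>A Julia-type inequality at the boundary point \<open>a\<close>. Along
  \<open>v n = \<omega> (z n)\<close> the fixed point equation makes \<open>D (v n)\<close> tend to
  \<open>(a - x) / c\<close>, and \<open>c * Im (D (v n)) < Im (v n)\<close> allows Schwarz-Pick to
  be divided by \<open>Im (v n)\<close> before the limit is taken.\<close>

lemma cluster_real_pick:
  assumes "cluster x (of_real a)" and w: "w \<in> upper_half_plane"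
  shows "c * (Im w * (cmod (D w - of_real ((a - x) / c)))\<^sup>2) \<le> (cmod (w - a))\<^sup>2 * Im (D w)"
proof -
  obtain z where z: "\<And>n::nat. z n \<in> upper_half_plane" "z \<longlonglongrightarrow> of_real x" "(\<lambda>n. \<omega> (z n)) \<longlonglongrightarrow> of_real a"
    using assms(1) by (auto simp: cluster_def)
  define v where "v n = \<omega> (z n)" for n
  have vU: "v n \<in> upper_half_plane" for n using in_uhp[OF z(1)] by (simp add: v_def)
  have Dv: "D (v n) = (v n - z n) / c" for n
    using eq[OF z(1)[of n]] c_pos by (simp add: v_def field_simps)
  have v: "v \<longlonglongrightarrow> of_real a" using z(3) by (simp add: v_def[abs_def])
  have "(\<lambda>n. D (v n)) \<longlonglongrightarrow> (complex_of_real a - of_real x) / of_real c"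
    unfolding Dv using c_pos by (intro tendsto_intros v z(2)) auto
  then have D: "(\<lambda>n. D (v n)) \<longlonglongrightarrow> of_real ((a - x) / c)" by simp
  have "c * (Im w * (cmod (D w - D (v n)))\<^sup>2) \<le> (cmod (w - v n))\<^sup>2 * Im (D w)" for n
  proof -
    have Iv: "0 < Im (v n)" using vU by (simp add: upper_half_plane_def)
    have "Im (v n) * (c * (Im w * (cmod (D w - D (v n)))\<^sup>2)) = c * (Im w * Im (v n) * (cmod (D w - D (v n)))\<^sup>2)"
      by (simp add: mult_ac)
    also have "\<dots> \<le> c * ((cmod (w - v n))\<^sup>2 * (Im (D w) * Im (D (v n))))"
      using Schwarz_Pick_upper_half_plane[OF holo nonneg w vU] c_pos by (intro mult_left_mono) auto
    also have "\<dots> = (cmod (w - v n))\<^sup>2 * (Im (D w) * (c * Im (D (v n))))" by (simp add: mult_ac)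
    also have "\<dots> \<le> (cmod (w - v n))\<^sup>2 * (Im (D w) * Im (v n))"
      using c_Im_D_less[OF z(1)[of n]] nonneg[OF w] unfolding v_def by (intro mult_left_mono) auto
    also have "\<dots> = Im (v n) * ((cmod (w - v n))\<^sup>2 * Im (D w))" by (simp add: mult_ac)
    finally show ?thesis using Iv by simp
  qed
  moreover have "(\<lambda>n. c * (Im w * (cmod (D w - D (v n)))\<^sup>2)) \<longlonglongrightarrow> c * (Im w * (cmod (D w - of_real ((a - x) / c)))\<^sup>2)"
    by (intro tendsto_intros D)
  moreover have "(\<lambda>n. (cmod (w - v n))\<^sup>2 * Im (D w)) \<longlonglongrightarrow> (cmod (w - of_real a))\<^sup>2 * Im (D w)"
    by (intro tendsto_intros v)
  ultimately show ?thesis by (intro LIMSEQ_le) auto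
qed

text \<open>At \<open>Complex a y\<close> the distance to \<open>a\<close> is \<open>y\<close>, so
  with \<open>E\<close> the difference on the left the boundary inequality reads
  \<open>c * y * (cmod E)\<^sup>2 \<le> y\<^sup>2 * Im E\<close>. Since
  \<open>Im E \<le> cmod E\<close>, one factor \<open>cmod E\<close> cancels.\<close>

lemma cluster_real_vertical:
  assumes "cluster x (of_real a)" and y: "0 < y"
  shows "cmod (D (Complex a y) - of_real ((a - x) / c)) \<le> y / c"
proof -
  let ?w = "Complex a y"
  define E where "E = D ?w - of_real ((a - x) / c)"
  have w: "?w \<in> upper_half_plane" using y by (simp add: upper_half_plane_def)
  have ya: "cmod (?w - of_real a) = y" using y by (simp add: cmod_def)
  have "c * (y * (cmod E)\<^sup>2) \<le> y\<^sup>2 * Im (D ?w)"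
    using cluster_real_pick[OF assms(1) w] ya by (simp add: E_def)
  also have "Im (D ?w) = Im E" by (simp add: E_def)
  also have "y\<^sup>2 * Im E \<le> y\<^sup>2 * cmod E" using abs_Im_le_cmod[of E] by (intro mult_left_mono) auto
  finally have "(y * cmod E) * (c * cmod E) \<le> (y * cmod E) * y" by (simp add: power2_eq_square mult_ac)
  then have "c * cmod E \<le> y"
    using y by (cases "E = 0") auto
  then show ?thesis using c_pos by (simp add: E_def field_simps)
qed

text \<open>
  On such an interval \<open>D w - (w - x) / c\<close> would have boundary value \<open>0\<close>, hence vanish identically by
  reflection, and \<open>H\<close> would be the constant \<open>x\<close>.
\<close>

lemma no_real_interval:
  assumes ab: "a < b" and cl: "\<And>k. a < k \<Longrightarrow> k < b \<Longrightarrow> cluster x (of_real k)"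
  shows False
proof -
  define R where "R = {w. a < Re w} \<inter> {w. Re w < b}"
  \<comment> \<open>The difference is extended by 0 below the axis, so once it is known to be
    continuous across the axis, the identity theorem applies from the lower half of the
    strip.\<close>
  define E where "E w = (if 0 < Im w then D w - (w - of_real x) / of_real c else 0)" for w
  have oR: "open R" unfolding R_def by (intro open_Int open_halfspace_Re_gt open_halfspace_Re_lt)
  have cR: "connected R" unfolding R_def
    by (intro convex_connected convex_Int convex_halfspace_Re_gt convex_halfspace_Re_lt)
  \<comment> \<open>The vertical estimate above \<open>Re w\<close> compares \<open>D w\<close> with
    \<open>(Re w - x) / c\<close>. Replacing \<open>Re w\<close> by \<open>w\<close> costs another
    \<open>Im w / c\<close>, hence the factor 2.\<close>
  have bnd: "cmod (E w) \<le> 2 * \<bar>Im w\<bar> / c" if "w \<in> R" for w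
  proof (cases "0 < Im w")
    case True
    have *: "cmod (D w - of_real ((Re w - x) / c)) \<le> Im w / c"
      using cluster_real_vertical[OF cl, of "Re w" "Im w"] that True by (simp add: R_def)
    have "E w = (D w - of_real ((Re w - x) / c)) - \<i> * of_real (Im w / c)"
      using True c_pos by (auto simp: E_def complex_eq_iff field_simps)
    then have "cmod (E w) \<le> cmod (D w - of_real ((Re w - x) / c)) + cmod (\<i> * of_real (Im w / c))"
      by (metis norm_triangle_ineq4)
    also have "cmod (\<i> * of_real (Im w / c)) = Im w / c"
      unfolding norm_mult norm_of_real using True c_pos by simp
    finally show ?thesis using * True by simp
  qed (use c_pos in \<open>simp add: E_def divide_nonpos_pos\<close>)
  have hol1: "E holomorphic_on upper_half_plane"
    by (rule holomorphic_transform[of "\<lambda>w. D w - (w - of_real x) / of_real c"])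
       (use c_pos in \<open>auto intro!: holomorphic_intros holo simp: E_def, simp add: upper_half_plane_def\<close>)
  have hol2: "E holomorphic_on {w. Im w < 0}"
    by (rule holomorphic_transform[of "\<lambda>w. 0"]) (auto simp: E_def)
  have "isCont E w" if w: "w \<in> R" for w
  proof -
    consider "0 < Im w" | "Im w < 0" | "Im w = 0" by linarith
    then show ?thesis
    proof cases
      case 1
      then show ?thesis
        using holomorphic_on_imp_continuous_on[OF hol1] open_upper_half_plane
        by (auto simp: continuous_on_eq_continuous_at upper_half_plane_def)
    next
      case 2
      then show ?thesis
        using holomorphic_on_imp_continuous_on[OF hol2] open_halfspace_Im_lt[of 0]
        by (auto simp: continuous_on_eq_continuous_at)
    next
      case 3
      have "(E \<longlongrightarrow> 0) (at w)"
      proof (rule Lim_null_comparison)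
        show "eventually (\<lambda>v. cmod (E v) \<le> 2 * \<bar>Im v\<bar> / c) (at w)"
          using eventually_at_topological oR w bnd by blast
        have "((\<lambda>v. 2 * \<bar>Im v\<bar> / c) \<longlongrightarrow> 2 * \<bar>Im w\<bar> / c) (at w)"
          using c_pos by (intro tendsto_intros) auto
        then show "((\<lambda>v. 2 * \<bar>Im v\<bar> / c) \<longlongrightarrow> 0) (at w)" by (simp add: 3)
      qed
      then show ?thesis by (simp add: isCont_def E_def 3)
    qed
  qed
  then have contE: "continuous_on R E"
    by (simp add: continuous_at_imp_continuous_on)
  have "E holomorphic_on R"
  proof (rule holomorphic_on_paste_across_line[OF oR _ _ _ contE, of \<i> 0])
    show "E holomorphic_on R \<inter> {z. \<i> \<bullet> z < 0}"
      by (rule holomorphic_on_subset[OF hol2]) (auto simp: inner_complex_def)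
    show "E holomorphic_on R \<inter> {z. 0 < \<i> \<bullet> z}"
      by (rule holomorphic_on_subset[OF hol1]) (auto simp: inner_complex_def upper_half_plane_def)
  qed simp
  moreover have m: "Complex ((a + b) / 2) y \<in> R" for y using ab by (auto simp: R_def)
  have "R \<inter> {w. Im w < 0} \<noteq> {}" using m[of "-1"] by force
  moreover have "open (R \<inter> {w. Im w < 0})" by (intro open_Int oR open_halfspace_Im_lt)
  ultimately have E0: "E w = 0" if "w \<in> R" for w
    using analytic_continuation_open[of "R \<inter> {w. Im w < 0}" R E "\<lambda>_. 0" w] oR cR that
    by (simp add: E_def)
  \<comment> \<open>Vanishing of \<open>E\<close> means \<open>c * D w = w - x\<close>. The identity
    theorem spreads the resulting constancy of \<open>H\<close> over the half plane, against
    \<open>H (\<omega> \<i>) = \<i>\<close>.\<close>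
  have "H w = of_real x" if "w \<in> R \<inter> upper_half_plane" for w
    using E0[of w] that c_pos by (simp add: E_def upper_half_plane_def H_def field_simps)
  moreover have "R \<inter> upper_half_plane \<noteq> {}" using m[of 1] by (force simp: upper_half_plane_def)
  moreover have "open (R \<inter> upper_half_plane)" by (intro open_Int oR open_upper_half_plane)
  ultimately have "H w = of_real x" if "w \<in> upper_half_plane" for w
    using analytic_continuation_open[of "R \<inter> upper_half_plane" upper_half_plane H "\<lambda>_. of_real x" w]
      open_upper_half_plane connected_upper_half_plane H_holo that by simp
  then have "\<i> = of_real x" using H_\<omega>[OF i_uhp] in_uhp[OF i_uhp] by metis
  then show False by (simp add: complex_eq_iff)
qed

text \<open>Interior cluster values are zeros of \<open>H - x\<close>, and these are isolated. A
  second cluster value would by connectedness produce one at any prescribed small distance from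
  \<open>a\<close>.\<close>

lemma cluster_interior_unique:
  assumes a: "cluster x a" "a \<in> upper_half_plane" and b: "cluster x b"
  shows "a = b"
proof (rule ccontr)
  assume ne: "a \<noteq> b"
  have "H (\<omega> \<i>) - of_real x \<noteq> 0" using H_\<omega>[OF i_uhp] by (simp add: complex_eq_iff)
  moreover have "(\<lambda>w. H w - of_real x) holomorphic_on upper_half_plane"
    by (intro holomorphic_intros H_holo)
  ultimately obtain r where r: "0 < r" "ball a r \<subseteq> upper_half_plane"
      "\<And>z. z \<in> ball a r - {a} \<Longrightarrow> H z - of_real x \<noteq> 0"
    using isolated_zeros[of "\<lambda>w. H w - of_real x" upper_half_plane a "\<omega> \<i>"]
      open_upper_half_plane connected_upper_half_plane a cluster_H[OF a] in_uhp[OF i_uhp]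
    by (metis cancel_comm_monoid_add_class.diff_cancel)
  define k where "k = min r (dist a b) / 2"
  have k: "0 < k" "k < dist a b" "k < r" using r(1) ne by (auto simp: k_def min_def)
  have "continuous_on UNIV (dist a)" by (intro continuous_intros)
  then obtain l where l: "cluster x l" "dist a l = k"
    using cluster_intermediate[OF a(1) b, of "dist a" k] k by auto
  then have "l \<in> ball a r - {a}" using k by auto
  then show False using r(2,3) cluster_H[OF l(1)] by fastforce
qed

text \<open>By the interior case two distinct cluster values make all cluster values real.
  Connectedness then fills the interval between them, which \<open>no_real_interval\<close>
  excludes.\<close>

lemma cluster_unique:
  assumes a: "cluster x a" and b: "cluster x b"
  shows "a = b"
proof (rule ccontr)
  assume ne: "a \<noteq> b"
  have real: "Im l = 0" if "cluster x l" for l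
  proof (rule ccontr)
    assume "Im l \<noteq> 0"
    then have "l \<in> upper_half_plane" using cluster_Im_nonneg[OF that] by (simp add: upper_half_plane_def)
    then show False using cluster_interior_unique[OF that _ a] cluster_interior_unique[OF that _ b] ne by simp
  qed
  have *: False if u: "cluster x u" and v: "cluster x v" and uv: "Re u < Re v" for u v
  proof (rule no_real_interval[OF uv, of x])
    fix k assume k: "Re u < k" "k < Re v"
    have "continuous_on UNIV Re" by (intro continuous_intros)
    then obtain l where l: "cluster x l" "Re l = k"
      using cluster_intermediate[OF u v _ k] by blast
    then have "l = of_real k" using real by (simp add: complex_eq_iff)
    with l show "cluster x (of_real k)" by simp
  qed
  have "Re a \<noteq> Re b" using ne real[OF a] real[OF b] by (simp add: complex_eq_iff)
  then show False using *[OF a b] *[OF b a] by linarith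
qed

text \<open>Vertical approach supplies one cluster value \<open>l\<close>. If convergence failed,
  compactness would give a cluster value at distance at least \<open>e\<close> from
  \<open>l\<close>.\<close>

lemma \<omega>_limit: "\<exists>l. (\<omega> \<longlongrightarrow> l) (at (of_real x) within upper_half_plane) \<and> cluster x l"
proof -
  have "(\<lambda>n. Complex x (inverse (real (Suc n)))) \<longlonglongrightarrow> Complex x 0"
    by (intro tendsto_intros LIMSEQ_inverse_real_of_nat)
  then have "(\<lambda>n. Complex x (inverse (real (Suc n)))) \<longlonglongrightarrow> of_real x"
    by (simp add: complex_of_real_def)
  then obtain l where l: "cluster x l"
    using bounded_seq_has_cluster[of "\<lambda>n. Complex x (inverse (real (Suc n)))" x]
    by (auto simp: upper_half_plane_def)
  have "(\<omega> \<longlongrightarrow> l) (at (of_real x) within upper_half_plane)"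
  proof (rule ccontr)
    assume "\<not> (\<omega> \<longlongrightarrow> l) (at (of_real x) within upper_half_plane)"
    then obtain e where e: "0 < e" "\<And>d. 0 < d \<Longrightarrow> \<exists>z\<in>upper_half_plane. dist z (of_real x) < d \<and> e \<le> dist (\<omega> z) l"
      unfolding Lim_within by (metis not_less)
    have "\<exists>z\<in>upper_half_plane. dist z (of_real x) < inverse (real (Suc n)) \<and> e \<le> dist (\<omega> z) l" for n
      by (rule e(2)) simp
    then obtain z where z: "\<And>n. z n \<in> upper_half_plane" "\<And>n. dist (z n) (of_real x) < inverse (real (Suc n))"
        "\<And>n. e \<le> dist (\<omega> (z n)) l" by metis
    have "z \<longlonglongrightarrow> of_real x"
      by (rule metric_tendsto_imp_tendsto[OF LIMSEQ_inverse_real_of_nat])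
         (intro always_eventually allI, use z(2) in \<open>auto simp: less_imp_le\<close>)
    then obtain m r where m: "(\<lambda>n. \<omega> (z (r n))) \<longlonglongrightarrow> m" "cluster x m"
      using bounded_seq_has_cluster[of z x] z(1) by metis
    have "(\<lambda>n. dist (\<omega> (z (r n))) l) \<longlonglongrightarrow> dist m l" by (intro tendsto_intros m)
    then have "e \<le> dist m l" by (rule LIMSEQ_le_const) (use z(3) in auto)
    then show False using cluster_unique[OF m(2) l] e(1) by simp
  qed
  with l show ?thesis by blast
qed

text \<open>
  At a critical point \<open>H\<close> is locally \<open>n\<close>-to-one with \<open>n \<ge> 2\<close>, also over points of the upper half plane,
  which contradicts injectivity on \<open>{Im H > 0}\<close>.
\<close>

lemma H_deriv_nonzero:
  assumes w0: "w0 \<in> upper_half_plane" and H0: "Im (H w0) = 0"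
  shows "deriv H w0 \<noteq> 0"
proof
  assume d0: "deriv H w0 = 0"
  \<comment> \<open>Otherwise \<open>H\<close> is constant, but \<open>H w0\<close> is real and
    \<open>H (\<omega> \<i>) = \<i>\<close>.\<close>
  have "\<exists>n>0. (deriv ^^ n) H w0 \<noteq> 0"
  proof (rule ccontr)
    assume "\<not> ?thesis"
    then have "(deriv ^^ n) H w0 = 0" if "0 < n" for n using that by blast
    then have "H (\<omega> \<i>) = H w0"
      using holomorphic_fun_eq_const_on_connected[OF H_holo open_upper_half_plane connected_upper_half_plane _ w0 in_uhp[OF i_uhp]]
      by blast
    then show False using H0 H_\<omega>[OF i_uhp] by simp
  qed
  then obtain n where n: "0 < n" "(deriv ^^ n) H w0 \<noteq> 0" "\<And>i. 0 < i \<Longrightarrow> i < n \<Longrightarrow> (deriv ^^ i) H w0 = 0"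
    using exists_least_iff[of "\<lambda>n. 0 < n \<and> (deriv ^^ n) H w0 \<noteq> 0"] by auto
  have n2: "2 \<le> n"
  proof (rule ccontr)
    assume "\<not> 2 \<le> n"
    then have "n = 1" using n(1) by simp
    then show False using n(2) d0 by simp
  qed
  obtain g r where r: "0 < r" "g holomorphic_on ball w0 r"
      "\<And>w. w \<in> ball w0 r \<Longrightarrow> H w - H w0 = ((w - w0) * g w) ^ n" "\<And>w. w \<in> ball w0 r \<Longrightarrow> g w \<noteq> 0"
    using holomorphic_factor_order_of_zero_strong[OF H_holo open_upper_half_plane w0 n] by metis
  \<comment> \<open>A local holomorphic \<open>n\<close>-th root of \<open>H - H w0\<close>. Its
    zero at \<open>w0\<close> is simple, so it is locally invertible and its image contains a disc
    about 0.\<close>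
  define \<psi> where "\<psi> w = (w - w0) * g w" for w
  define S where "S = ball w0 r \<inter> upper_half_plane"
  have S: "open S" "w0 \<in> S" using r(1) w0 open_upper_half_plane by (auto simp: S_def)
  have hol: "\<psi> holomorphic_on S"
    unfolding \<psi>_def by (intro holomorphic_intros holomorphic_on_subset[OF r(2)]) (auto simp: S_def)
  have "g field_differentiable at w0"
    using r(1,2) holomorphic_on_imp_differentiable_at[of g "ball w0 r" w0] by simp
  then have "(g has_field_derivative deriv g w0) (at w0)" by (simp add: DERIV_deriv_iff_field_differentiable)
  then have "(\<psi> has_field_derivative g w0) (at w0)"
    unfolding \<psi>_def by (auto intro!: derivative_eq_intros)
  then have "deriv \<psi> w0 \<noteq> 0" using r(1,4) by (simp add: DERIV_imp_deriv)
  then obtain s where s: "0 < s" "ball w0 s \<subseteq> S" "open (\<psi> ` ball w0 s)" "inj_on \<psi> (ball w0 s)"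
    using has_complex_derivative_locally_invertible[OF hol S(2,1)] by metis
  have "0 \<in> \<psi> ` ball w0 s" using s(1) by (auto simp: \<psi>_def intro!: image_eqI[of _ _ w0])
  then obtain e where e: "0 < e" "ball 0 e \<subseteq> \<psi> ` ball w0 s" using s(3) openE by metis
  \<comment> \<open>The argument \<open>pi / (2 * n)\<close> makes \<open>p ^ n\<close> a positive
    multiple of \<open>\<i>\<close>, so that \<open>Im H\<close> is positive at the preimages;
    \<open>q\<close> is another \<open>n\<close>-th root of the same number, distinct because
    \<open>n \<ge> 2\<close>.\<close>
  define p where "p = cis (pi / (2 * n)) * (e / 2)"
  define q where "q = p * cis (2 * pi / n)"
  have pn: "p ^ n = \<i> * of_real ((e / 2) ^ n)"
  proof -
    have "cis (pi / (2 * n)) ^ n = \<i>" using n(1) by (subst Complex.DeMoivre) simp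
    then show ?thesis unfolding p_def power_mult_distrib by simp
  qed
  have qn: "q ^ n = p ^ n" using n(1) by (simp add: q_def power_mult_distrib Complex.DeMoivre)
  have "cis (2 * pi / n) \<noteq> 1"
  proof
    assume "cis (2 * pi / n) = 1"
    then have "cos (2 * pi / n) = 1" by (simp add: complex_eq_iff)
    moreover have "cos (2 * pi / n) < cos 0"
      using n2 by (intro cos_monotone_0_pi) (auto simp: field_simps)
    ultimately show False by simp
  qed
  moreover have p0: "p \<noteq> 0" using e(1) by (simp add: p_def)
  ultimately have pq: "p \<noteq> q" by (simp add: q_def)
  have "norm p < e" "norm q < e" using e(1) by (auto simp: p_def q_def norm_mult)
  then have "p \<in> \<psi> ` ball w0 s" "q \<in> \<psi> ` ball w0 s" using e(2) by (simp_all add: subset_iff)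
  then obtain u v where uv: "u \<in> ball w0 s" "v \<in> ball w0 s" "\<psi> u = p" "\<psi> v = q"
    by (elim imageE) simp
  have \<psi>: "H w - H w0 = \<psi> w ^ n" if "w \<in> ball w0 s" for w
    unfolding \<psi>_def by (rule r(3)) (use that s(2) in \<open>auto simp: S_def\<close>)
  have "H u - H w0 = p ^ n" "H v - H w0 = p ^ n"
    using \<psi>[OF uv(1)] \<psi>[OF uv(2)] unfolding uv(3,4) qn .
  then have Hu: "H u = H w0 + p ^ n" and Hv: "H v = H w0 + p ^ n"
    by (simp_all only: diff_eq_eq add.commute)
  have "Im (p ^ n) = (e / 2) ^ n" unfolding pn by (simp only: Im_i_times Re_complex_of_real)
  then have "0 < Im (H u)" using H0 e(1) by (simp add: Hu)
  moreover have "u \<in> upper_half_plane" "v \<in> upper_half_plane" using uv(1,2) s(2) unfolding S_def by blast+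
  ultimately have "u = v" by (rule_tac H_inj) (simp_all only: Hu Hv)
  then show False using uv pq by simp
qed

text \<open>\<open>H\<close> has nonzero derivative at \<open>l\<close>, hence a holomorphic local
  inverse \<open>k\<close> around \<open>x\<close>. For \<open>z\<close> near \<open>x\<close> the
  value \<open>\<omega> z\<close> is near \<open>l\<close>, where \<open>H (\<omega> z) = z\<close>
  identifies it with \<open>k z\<close>.\<close>

lemma \<omega>_local_extension:
  assumes l: "(\<omega> \<longlongrightarrow> l) (at (of_real x) within upper_half_plane)" and lU: "l \<in> upper_half_plane" and "cluster x l"
  obtains k r where "0 < r" "k holomorphic_on ball (of_real x) r"
    "\<And>z. z \<in> ball (of_real x) r \<inter> upper_half_plane \<Longrightarrow> \<omega> z = k z"
proof -
  have Hl: "H l = of_real x" by (rule cluster_H[OF assms(3) lU])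
  obtain s where s: "0 < s" "ball l s \<subseteq> upper_half_plane" "open (H ` ball l s)" "inj_on H (ball l s)"
    using has_complex_derivative_locally_invertible[OF H_holo lU open_upper_half_plane H_deriv_nonzero[OF lU]] Hl
    by auto
  obtain k where k: "k holomorphic_on H ` ball l s" "\<And>z. z \<in> ball l s \<Longrightarrow> k (H z) = z"
    using holomorphic_has_inverse[OF holomorphic_on_subset[OF H_holo s(2)] open_ball s(4)] by metis
  have "of_real x \<in> H ` ball l s" using Hl s(1) by (metis centre_in_ball imageI)
  then obtain e where e: "0 < e" "ball (of_real x) e \<subseteq> H ` ball l s" using s(3) openE by metis
  obtain d where d: "0 < d" "\<And>z. z \<in> upper_half_plane \<Longrightarrow> dist z (of_real x) < d \<Longrightarrow> dist (\<omega> z) l < s"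
    using l s(1) unfolding Lim_within
    by (metis Im_complex_of_real dist_pos_lt less_irrefl mem_Collect_eq upper_half_plane_def)
  show ?thesis
  proof (rule that)
    show "0 < min d e" using d e by simp
    show "k holomorphic_on ball (of_real x) (min d e)"
      by (rule holomorphic_on_subset[OF k(1)]) (use e in auto)
    fix z assume z: "z \<in> ball (of_real x) (min d e) \<inter> upper_half_plane"
    then have "\<omega> z \<in> ball l s" using d(2)[of z] by (simp add: dist_commute)
    then show "\<omega> z = k z" using k(2)[of "\<omega> z"] H_\<omega>[of z] z by simp
  qed
qed

end

section \<open>Cauchy transforms and Stieltjes inversion\<close>

lemma at_within_upper_half_plane_nontrivial:
  "at (complex_of_real x) within upper_half_plane \<noteq> bot"
proof -
  have "of_real x islimpt upper_half_plane"
    unfolding islimpt_approachable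
  proof (intro allI impI)
    fix e :: real assume "0 < e"
    then show "\<exists>z\<in>upper_half_plane. z \<noteq> of_real x \<and> dist z (of_real x) < e"
      by (intro bexI[of _ "of_real x + \<i> * of_real (e / 2)"])
         (auto simp: upper_half_plane_def complex_eq_iff dist_norm norm_mult simp del: of_real_divide)
  qed
  then show ?thesis by (simp add: trivial_limit_within)
qed

text \<open>Limits at all real points force continuity of the boundary function itself: a boundary
  value near \<open>z\<close> is a limit of interior values that are within \<open>e / 2\<close> of
  \<open>b (Re z)\<close>.\<close>

lemma continuous_on_boundary_extension:
  fixes f :: "complex \<Rightarrow> complex"
  assumes f: "continuous_on upper_half_plane f"
    and b: "\<And>x. (f \<longlongrightarrow> b x) (at (of_real x) within upper_half_plane)"
  shows "continuous_on {z. 0 \<le> Im z} (\<lambda>z. if 0 < Im z then f z else b (Re z))"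
    (is "continuous_on _ ?g")
  unfolding continuous_on_eq_continuous_within
proof (intro ballI)
  fix z assume "z \<in> {z. 0 \<le> Im z}"
  then consider "0 < Im z" | "Im z = 0" by (auto simp: le_less)
  then show "continuous (at z within {z. 0 \<le> Im z}) ?g"
  proof cases
    case 1
    then have "isCont f z"
      using f open_upper_half_plane by (auto simp: continuous_on_eq_continuous_at upper_half_plane_def)
    moreover have "eventually (\<lambda>w. ?g w = f w) (nhds z)"
      using eventually_nhds_in_open[OF open_upper_half_plane, of z] 1
      by (auto elim!: eventually_mono simp: upper_half_plane_def)
    ultimately have "isCont ?g z" by (subst isCont_cong) auto
    then show ?thesis by (rule continuous_at_imp_continuous_at_within)
  next
    case 2
    then have z: "z = of_real (Re z)" by (simp add: complex_eq_iff)
    show ?thesis unfolding continuous_within_eps_delta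
    proof (intro allI impI)
      fix e :: real assume e: "0 < e"
      obtain d where d: "0 < d" "\<And>w. w \<in> upper_half_plane \<Longrightarrow> dist w z < d \<Longrightarrow> dist (f w) (b (Re z)) < e / 2"
        using b[of "Re z"] e z unfolding Lim_within
        by (metis dist_nz half_gt_zero mem_Collect_eq upper_half_plane_def 2 less_irrefl)
      have "dist (?g w) (b (Re z)) < e" if w: "0 \<le> Im w" "dist w z < d" for w
      proof (cases "0 < Im w")
        case True
        then show ?thesis using d(2)[of w] w e by (simp add: upper_half_plane_def)
      next
        case False
        then have w': "w = of_real (Re w)" using w by (simp add: complex_eq_iff)
        have "eventually (\<lambda>v. dist v z < d) (at w within upper_half_plane)"
          using w(2) by (intro order_tendstoD(2)[OF tendsto_dist[OF tendsto_ident_at tendsto_const]])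
        moreover have "eventually (\<lambda>v. v \<in> upper_half_plane) (at w within upper_half_plane)"
          by (simp add: eventually_at_filter)
        ultimately have "eventually (\<lambda>v. dist (f v) (b (Re z)) \<le> e / 2) (at w within upper_half_plane)"
          by eventually_elim (use d(2) in \<open>auto simp: less_imp_le\<close>)
        moreover have "((\<lambda>v. dist (f v) (b (Re z))) \<longlongrightarrow> dist (b (Re w)) (b (Re z))) (at w within upper_half_plane)"
          using b[of "Re w"] w' by (intro tendsto_intros) auto
        ultimately have "dist (b (Re w)) (b (Re z)) \<le> e / 2"
          using at_within_upper_half_plane_nontrivial[of "Re w"] w' by (metis tendsto_upperbound)
        then show ?thesis using False e by simp
      qed
      then have "\<forall>w\<in>{z. 0 \<le> Im z}. dist w z < d \<longrightarrow> dist (?g w) (?g z) < e"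
        by (simp only: 2 less_irrefl if_False) blast
      with d(1) show "\<exists>d>0. \<forall>w\<in>{z. 0 \<le> Im z}. dist w z < d \<longrightarrow> dist (?g w) (?g z) < e"
        by blast
    qed
  qed
qed

section \<open>Integrals of the Poisson kernel and their limits at the axis\<close>

lemma integral_Poisson_kernel:
  fixes c d s y :: real
  assumes "c \<le> d" "0 < y"
  shows "(\<integral>\<^sup>+x. ennreal (y / ((x - s)\<^sup>2 + y\<^sup>2)) * indicator {c..d} x \<partial>lborel) =
    ennreal (arctan ((d - s) / y) - arctan ((c - s) / y))"
proof (rule nn_integral_FTC_Icc)
  show "((\<lambda>x. arctan ((x - s) / y)) has_real_derivative y / ((x - s)\<^sup>2 + y\<^sup>2)) (at x)" for x
  proof -
    have "((\<lambda>x. arctan ((x - s) / y)) has_field_derivative inverse (1 + ((x - s) / y)\<^sup>2) * (1 / y)) (at x)"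
      using assms(2) by (auto intro!: derivative_eq_intros)
    moreover have "inverse (1 + ((x - s) / y)\<^sup>2) * (1 / y) = y / ((x - s)\<^sup>2 + y\<^sup>2)"
      using assms(2) by (simp add: field_simps power2_eq_square)
    ultimately show ?thesis by simp
  qed
qed (use assms in auto)

text \<open>The primitive of the Poisson kernel at the heights \<open>1 / real (Suc n)\<close> used
  for vertical approach. The value \<open>sgn 0 = 0\<close> covers the endpoint of an
  interval.\<close>

lemma tendsto_arctan_scaled:
  fixes r :: real
  shows "(\<lambda>n. arctan (r / (1 / real (Suc n)))) \<longlonglongrightarrow> pi / 2 * sgn r"
proof -
  have lim: "(\<lambda>n. arctan (r * real (Suc n))) \<longlonglongrightarrow> pi / 2 * sgn r"
  proof -
    consider "r = 0" | "0 < r" | "r < 0" by linarith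
    then show ?thesis
    proof cases
      case 2
      have "filterlim (\<lambda>n. r * real (Suc n)) at_top sequentially"
        by (rule filterlim_tendsto_pos_mult_at_top[OF tendsto_const 2])
           (rule filterlim_compose[OF filterlim_real_sequentially filterlim_Suc])
      from filterlim_compose[OF tendsto_arctan_at_top this] 2 show ?thesis by simp
    next
      case 3
      have "filterlim (\<lambda>n. r * real (Suc n)) at_bot sequentially"
        by (rule filterlim_tendsto_neg_mult_at_bot[OF tendsto_const 3])
           (rule filterlim_compose[OF filterlim_real_sequentially filterlim_Suc])
      from filterlim_compose[OF tendsto_arctan_at_bot this] 3 show ?thesis by simp
    qed simp
  qed
  then show ?thesis by simp
qed

context real_distribution
begin

section \<open>Kernel bounds, holomorphy and imaginary parts\<close>

lemma cauchy_kernel_bound: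
  assumes "0 < Im z" shows "cmod (1 / (z - of_real s)) \<le> 1 / Im z"
proof -
  have "Im z \<le> cmod (z - of_real s)" using abs_Im_le_cmod[of "z - of_real s"] by simp
  then show ?thesis using assms by (simp add: norm_divide frac_le)
qed

lemma cauchy_kernel_integrable:
  assumes "0 < Im z" shows "integrable M (\<lambda>s. 1 / (z - complex_of_real s))"
  by (rule integrable_const_bound[of _ "1 / Im z"]) (use cauchy_kernel_bound[OF assms] in auto)

lemma cauchy_kernel_square_integrable:
  assumes "0 < Im z" shows "integrable M (\<lambda>s. (cmod (1 / (z - complex_of_real s)))\<^sup>2)"
  by (rule integrable_const_bound[of _ "(1 / Im z)\<^sup>2"])
     (use cauchy_kernel_bound[OF assms] in \<open>auto intro!: power_mono simp del: norm_divide norm_one\<close>)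

lemma cauchy_transform_holomorphic: "cauchy_transform M holomorphic_on upper_half_plane"
proof -
  have "cauchy_transform M field_differentiable at z" if "z \<in> upper_half_plane" for z
  proof -
    have Iz: "0 < Im z" using that by (simp add: upper_half_plane_def)
    \<comment> \<open>Above half the height of \<open>z\<close> the kernel is bounded by
      \<open>1 / (Im z / 2)\<close>, which gives a constant dominating function for differentiation
      under the integral.\<close>
    define S where "S = {w. Im z / 2 < Im w}"
    have S: "open S" "z \<in> S" using Iz by (simp_all only: S_def open_halfspace_Im_gt) simp
    have "((\<lambda>w. (cauchy_transform M w - cauchy_transform M z) / (w - z)) \<longlongrightarrow>
        (LINT s|M. - (1 / (z - complex_of_real s) * (1 / (z - complex_of_real s))))) (at z within S)"
      unfolding tendsto_at_iff_sequentially o_def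
    proof (intro allI impI)
      fix X :: "nat \<Rightarrow> complex" assume XS: "\<forall>i. X i \<in> S - {z}" and X: "X \<longlonglongrightarrow> z"
      have IX: "Im z / 2 < Im (X i)" "0 < Im (X i)" "X i \<noteq> z" for i
        using XS Iz by (auto simp: S_def intro: less_trans[of 0 "Im z / 2"])
      have ne: "w - complex_of_real s \<noteq> 0" if "0 < Im w" for w s
        using that by (auto simp: complex_eq_iff)
      have eq: "(cauchy_transform M (X i) - cauchy_transform M z) / (X i - z) =
          (LINT s|M. - (1 / (X i - complex_of_real s) * (1 / (z - complex_of_real s))))" for i
      proof -
        have "cauchy_transform M (X i) - cauchy_transform M z =
            (LINT s|M. 1 / (X i - complex_of_real s) - 1 / (z - complex_of_real s))"
          unfolding cauchy_transform_def using IX Iz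
          by (intro Bochner_Integration.integral_diff[symmetric] cauchy_kernel_integrable)
        also have "\<dots> = (LINT s|M. (- (1 / (X i - complex_of_real s) * (1 / (z - complex_of_real s)))) * (X i - z))"
        proof (intro Bochner_Integration.integral_cong refl)
          have inv: "1 / a - 1 / b = - (1 / a * (1 / b)) * (a - b)" if "a \<noteq> 0" "b \<noteq> 0" for a b :: complex
            using that by (simp add: field_simps)
          show "1 / (X i - complex_of_real s) - 1 / (z - complex_of_real s) =
              - (1 / (X i - complex_of_real s) * (1 / (z - complex_of_real s))) * (X i - z)" for s
            using inv[OF ne[OF IX(2)] ne[OF Iz], of i s s] by simp
        qed
        also have "\<dots> = (LINT s|M. - (1 / (X i - complex_of_real s) * (1 / (z - complex_of_real s)))) * (X i - z)"
          by (rule integral_mult_left_zero)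
        finally show ?thesis using IX(3)[of i] by simp
      qed
      show "(\<lambda>i. (cauchy_transform M (X i) - cauchy_transform M z) / (X i - z)) \<longlonglongrightarrow>
          (LINT s|M. - (1 / (z - complex_of_real s) * (1 / (z - complex_of_real s))))"
        unfolding eq
      proof (rule integral_dominated_convergence[where w = "\<lambda>_. 1 / (Im z / 2) * (1 / Im z)"])
        show "AE s in M. (\<lambda>i. - (1 / (X i - complex_of_real s) * (1 / (z - complex_of_real s))))
            \<longlonglongrightarrow> - (1 / (z - complex_of_real s) * (1 / (z - complex_of_real s)))"
          using ne[OF Iz] by (intro AE_I2 tendsto_intros X) auto
        show "AE s in M. norm (- (1 / (X i - complex_of_real s) * (1 / (z - complex_of_real s)))) \<le> 1 / (Im z / 2) * (1 / Im z)" for i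
        proof (intro AE_I2)
          fix s
          have "cmod (1 / (X i - complex_of_real s)) \<le> 1 / Im (X i)" by (rule cauchy_kernel_bound[OF IX(2)])
          also have "\<dots> \<le> 1 / (Im z / 2)" using IX(1)[of i] Iz by (intro frac_le) auto
          finally show "norm (- (1 / (X i - complex_of_real s) * (1 / (z - complex_of_real s)))) \<le> 1 / (Im z / 2) * (1 / Im z)"
            unfolding norm_minus_cancel norm_mult using cauchy_kernel_bound[OF Iz] Iz
            by (intro mult_mono) auto
        qed
      qed auto
    qed
    then show ?thesis
      unfolding field_differentiable_def has_field_derivative_iff using at_within_open[OF S(2,1)] by auto
  qed
  then show ?thesis by (auto simp: holomorphic_on_def intro: field_differentiable_at_within)
qed

lemma Im_cauchy_transform:
  assumes "0 < Im z"
  shows "- Im (cauchy_transform M z) = Im z * (LINT s|M. (cmod (1 / (z - complex_of_real s)))\<^sup>2)"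
proof -
  have "- Im (1 / (z - complex_of_real s)) = Im z * (cmod (1 / (z - complex_of_real s)))\<^sup>2" for s
    by (simp add: Im_divide' norm_divide power_divide)
  then have "Im z * (LINT s|M. (cmod (1 / (z - complex_of_real s)))\<^sup>2) = (LINT s|M. - Im (1 / (z - complex_of_real s)))"
    by simp
  also have "\<dots> = - Im (cauchy_transform M z)"
    unfolding cauchy_transform_def using integral_bounded_linear[OF bounded_linear_Im cauchy_kernel_integrable[OF assms]]
    by simp
  finally show ?thesis by simp
qed

text \<open>The modulus of the kernel has nonnegative variance.\<close>

lemma cauchy_transform_sq_le:
  assumes "0 < Im z"
  shows "(cmod (cauchy_transform M z))\<^sup>2 \<le> (LINT s|M. (cmod (1 / (z - complex_of_real s)))\<^sup>2)"
proof -
  let ?X = "\<lambda>s. cmod (1 / (z - complex_of_real s))"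
  have "cmod (cauchy_transform M z) \<le> expectation ?X"
    unfolding cauchy_transform_def by (rule integral_norm_bound)
  then have "(cmod (cauchy_transform M z))\<^sup>2 \<le> (expectation ?X)\<^sup>2" by (intro power_mono) auto
  also have "\<dots> \<le> expectation (\<lambda>s. (?X s)\<^sup>2)"
    using variance_eq[OF integrable_norm[OF cauchy_kernel_integrable[OF assms]] cauchy_kernel_square_integrable[OF assms]]
      variance_positive[of ?X] by simp
  finally show ?thesis .
qed

lemma Im_cauchy_transform_neg:
  assumes "0 < Im z" shows "Im (cauchy_transform M z) < 0"
proof -
  have "(LINT s|M. (cmod (1 / (z - complex_of_real s)))\<^sup>2) \<noteq> 0"
  proof
    assume "(LINT s|M. (cmod (1 / (z - complex_of_real s)))\<^sup>2) = 0"
    then have "AE s in M. (cmod (1 / (z - complex_of_real s)))\<^sup>2 = 0"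
      by (subst (asm) integral_nonneg_eq_0_iff_AE) (auto simp: cauchy_kernel_square_integrable[OF assms] simp del: norm_divide)
    moreover have "(cmod (1 / (z - complex_of_real s)))\<^sup>2 \<noteq> 0" for s
    proof -
      have "z - complex_of_real s \<noteq> 0" using assms by (auto simp: complex_eq_iff)
      then show ?thesis by simp
    qed
    ultimately have "AE s in M. False" by simp
    then show False by simp
  qed
  moreover have "0 \<le> (LINT s|M. (cmod (1 / (z - complex_of_real s)))\<^sup>2)" by (intro integral_nonneg_AE) auto
  ultimately have "0 < (LINT s|M. (cmod (1 / (z - complex_of_real s)))\<^sup>2)" by linarith
  then have "0 < - Im (cauchy_transform M z)"
    unfolding Im_cauchy_transform[OF assms] using assms by (intro mult_pos_pos)
  then show ?thesis by simp
qed

lemma cauchy_transform_nonzero: "0 < Im z \<Longrightarrow> cauchy_transform M z \<noteq> 0"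
  using Im_cauchy_transform_neg[of z] by auto

lemma F_transform_holomorphic: "F_transform M holomorphic_on upper_half_plane"
  unfolding F_transform_def[abs_def]
  by (intro holomorphic_intros cauchy_transform_holomorphic)
     (auto simp: upper_half_plane_def cauchy_transform_nonzero)

lemma Im_F_transform: "Im (F_transform M z) = - Im (cauchy_transform M z) / (cmod (cauchy_transform M z))\<^sup>2"
  by (simp add: F_transform_def Im_divide')

text \<open>By \<open>Im_cauchy_transform\<close> this is the variance inequality divided by
  \<open>(cmod (cauchy_transform M z))\<^sup>2\<close>. It puts \<open>F_transform M z - z\<close>
  in the closed half plane, as the locale \<open>subordination\<close> requires of
  \<open>D\<close>.\<close>

lemma Im_F_transform_ge:
  assumes "0 < Im z" shows "Im z \<le> Im (F_transform M z)"
proof -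
  have "Im z * (cmod (cauchy_transform M z))\<^sup>2 \<le> - Im (cauchy_transform M z)"
    unfolding Im_cauchy_transform[OF assms] using cauchy_transform_sq_le[OF assms] assms
    by (intro mult_left_mono) auto
  then show ?thesis
    using cauchy_transform_nonzero[OF assms] by (simp add: Im_F_transform field_simps)
qed

text \<open>The functions \<open>(z n - x) / (z n - s)\<close> of \<open>s\<close> converge to the
  indicator of \<open>{x}\<close>, and nontangential approach bounds them by the aperture constant
  \<open>C\<close>, so dominated convergence applies.\<close>

lemma cauchy_transform_atom:
  assumes z: "\<And>n::nat. 0 < Im (z n)" "z \<longlonglongrightarrow> of_real x" "\<And>n. cmod (z n - of_real x) \<le> C * Im (z n)"
  shows "(\<lambda>n. (z n - of_real x) * cauchy_transform M (z n)) \<longlonglongrightarrow> of_real (measure M {x})"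
proof -
  have "(\<lambda>n. LINT s|M. (z n - of_real x) * (1 / (z n - of_real s))) \<longlonglongrightarrow> (LINT s|M. of_real (indicator {x} s))"
  proof (rule integral_dominated_convergence[where w = "\<lambda>_. C"])
    show "AE s in M. (\<lambda>n. (z n - of_real x) * (1 / (z n - of_real s))) \<longlonglongrightarrow> of_real (indicator {x} s)"
    proof (intro AE_I2)
      fix s
      have "z n \<noteq> of_real x" for n using z(1)[of n] by (auto simp: complex_eq_iff)
      moreover have "(\<lambda>n. (z n - of_real x) * (1 / (z n - of_real s))) \<longlonglongrightarrow> (of_real x - of_real x) * (1 / (of_real x - of_real s))"
        if "s \<noteq> x" using that by (intro tendsto_intros z(2)) auto
      ultimately show "(\<lambda>n. (z n - of_real x) * (1 / (z n - of_real s))) \<longlonglongrightarrow> of_real (indicator {x} s)"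
        by (cases "s = x") auto
    qed
    show "AE s in M. norm ((z n - of_real x) * (1 / (z n - of_real s))) \<le> C" for n
    proof (intro AE_I2)
      fix s
      have "norm ((z n - of_real x) * (1 / (z n - of_real s))) \<le> (C * Im (z n)) * (1 / Im (z n))"
        unfolding norm_mult using z(1)[of n] z(3)[of n] cauchy_kernel_bound[OF z(1)]
        by (intro mult_mono) (auto intro: order_trans[OF norm_ge_zero])
      then show "norm ((z n - of_real x) * (1 / (z n - of_real s))) \<le> C" using z(1)[of n] by simp
    qed
  qed auto
  moreover have "(LINT s|M. complex_of_real (indicator {x} s)) = of_real (measure M {x})"
    by simp
  moreover have "(LINT s|M. (z n - of_real x) * (1 / (z n - of_real s))) = (z n - of_real x) * cauchy_transform M (z n)" for n
    unfolding cauchy_transform_def by (rule integral_mult_right_zero)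
  ultimately show ?thesis by simp
qed

text \<open>The atom alone contributes \<open>measure M {a} / y\<close> to \<open>- Im\<close> of
  the Cauchy transform at \<open>Complex a y\<close>. The strict version is for the borderline mass
  \<open>(t - 1) / t\<close>, where strictness can only come from the remaining mass.\<close>

lemma F_transform_above_atom:
  assumes m: "0 < measure M {a}" and y: "0 < y"
  shows "cmod (F_transform M (Complex a y)) \<le> y / measure M {a}"
    and "measure M {a} < 1 \<Longrightarrow> Im (F_transform M (Complex a y)) < y / measure M {a}"
proof -
  let ?z = "Complex a y"
  let ?G = "cauchy_transform M ?z"
  let ?k = "\<lambda>s. (cmod (1 / (?z - complex_of_real s)))\<^sup>2"
  let ?i = "\<lambda>s. indicator {a} s * (1 / y\<^sup>2)"
  have Iz: "0 < Im ?z" using y by simp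
  have int: "integrable M ?i" "integrable M ?k"
    by (rule integrable_const_bound[of _ "1 / y\<^sup>2"], simp add: indicator_def, measurable)
       (rule cauchy_kernel_square_integrable[OF Iz])
  have le: "?i s \<le> ?k s" for s
    using y by (auto simp: indicator_def norm_divide power_divide cmod_power2)
  have i: "(LINT s|M. ?i s) = measure M {a} / y\<^sup>2" by simp
  have w: "measure M {a} / y\<^sup>2 \<le> (LINT s|M. ?k s)"
    unfolding i[symmetric] using le by (intro integral_mono int)
  have st: "measure M {a} / y\<^sup>2 < (LINT s|M. ?k s)" if "measure M {a} < 1"
  proof -
    \<comment> \<open>Off \<open>a\<close> the kernel is strictly larger than the contribution of
      the atom, so equal integrals would concentrate \<open>M\<close> at \<open>a\<close>.\<close>
    have "(LINT s|M. ?k s - ?i s) \<noteq> 0"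
    proof
      assume "(LINT s|M. ?k s - ?i s) = 0"
      then have "AE s in M. ?k s - ?i s = 0"
        using le by (subst (asm) integral_nonneg_eq_0_iff_AE[OF Bochner_Integration.integrable_diff[OF int(2,1)]]) auto
      moreover have "?k s - ?i s \<noteq> 0" if "s \<noteq> a" for s
      proof -
        have "Complex a y - complex_of_real s \<noteq> 0" using y by (simp add: complex_eq_iff)
        then show ?thesis using that by simp
      qed
      ultimately have "AE s in M. s \<in> {a}" by (rule_tac eventually_mono) blast+
      then have "measure M {a} = 1" by (subst prob_eq_1) auto
      with that show False by simp
    qed
    then show ?thesis using w int i by (simp add: Bochner_Integration.integral_diff)
  qed
  have neg: "0 < - Im ?G" using Im_cauchy_transform_neg[OF Iz] by simp
  have "Im (F_transform M ?z) \<le> - Im ?G / (Im ?G)\<^sup>2"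
    unfolding Im_F_transform using neg by (intro divide_left_mono) (auto simp: cmod_power2 intro!: mult_pos_pos add_nonneg_pos)
  also have "\<dots> = 1 / (- Im ?G)" using neg by (simp add: power2_eq_square)
  finally have F: "Im (F_transform M ?z) \<le> 1 / (- Im ?G)" .
  have G: "- Im ?G = y * (LINT s|M. ?k s)" using Im_cauchy_transform[OF Iz] by simp
  have "measure M {a} / y \<le> - Im ?G"
    unfolding G using mult_left_mono[OF w, of y] y by (simp add: power2_eq_square)
  then have "inverse (- Im ?G) \<le> inverse (measure M {a} / y)" by (rule le_imp_inverse_le) (use m y in simp)
  moreover have "cmod (F_transform M ?z) \<le> inverse (- Im ?G)"
    unfolding F_transform_def inverse_eq_divide[symmetric] norm_inverse
    by (rule le_imp_inverse_le) (use abs_Im_le_cmod[of ?G] neg in auto)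
  ultimately show "cmod (F_transform M ?z) \<le> y / measure M {a}" by (simp add: inverse_eq_divide)
  assume "measure M {a} < 1"
  from mult_strict_left_mono[OF st[OF this], of y] have "measure M {a} / y < - Im ?G"
    unfolding G using y by (simp add: power2_eq_square)
  then have "inverse (- Im ?G) < inverse (measure M {a} / y)" by (rule less_imp_inverse_less) (use m y in simp)
  with F show "Im (F_transform M ?z) < y / measure M {a}" by (simp add: inverse_eq_divide)
qed

section \<open>Stieltjes inversion\<close>

lemma nn_integral_Im_cauchy_transform:
  assumes "c \<le> d" "0 < y"
  shows "(\<integral>\<^sup>+x. ennreal (- Im (cauchy_transform M (Complex x y))) * indicator {c..d} x \<partial>lborel) =
    (\<integral>\<^sup>+s. ennreal (arctan ((d - s) / y) - arctan ((c - s) / y)) \<partial>M)"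
proof -
  interpret pair_sigma_finite lborel M ..
  have k: "ennreal (- Im (cauchy_transform M (Complex x y))) = (\<integral>\<^sup>+s. ennreal (y / ((x - s)\<^sup>2 + y\<^sup>2)) \<partial>M)" for x
  proof -
    have y: "0 < Im (Complex x y)" using assms by simp
    have e: "y / ((x - s)\<^sup>2 + y\<^sup>2) = y * (cmod (1 / (Complex x y - complex_of_real s)))\<^sup>2" for s
      by (simp add: norm_divide power_divide cmod_power2)
    have "(\<integral>\<^sup>+s. ennreal (y / ((x - s)\<^sup>2 + y\<^sup>2)) \<partial>M) =
        ennreal (LINT s|M. y * (cmod (1 / (Complex x y - complex_of_real s)))\<^sup>2)"
      unfolding e using assms
      by (intro nn_integral_eq_integral integrable_mult_right cauchy_kernel_square_integrable) auto
    then show ?thesis using Im_cauchy_transform[OF y] by simp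
  qed
  have "(\<integral>\<^sup>+x. ennreal (- Im (cauchy_transform M (Complex x y))) * indicator {c..d} x \<partial>lborel) =
      (\<integral>\<^sup>+x. (\<integral>\<^sup>+s. ennreal (y / ((x - s)\<^sup>2 + y\<^sup>2)) * indicator {c..d} x \<partial>M) \<partial>lborel)"
    unfolding k by (intro nn_integral_cong nn_integral_multc[symmetric]) measurable
  also have "\<dots> = (\<integral>\<^sup>+s. (\<integral>\<^sup>+x. ennreal (y / ((x - s)\<^sup>2 + y\<^sup>2)) * indicator {c..d} x \<partial>lborel) \<partial>M)"
    by (rule Fubini'[symmetric]) measurable
  also have "\<dots> = (\<integral>\<^sup>+s. ennreal (arctan ((d - s) / y) - arctan ((c - s) / y)) \<partial>M)"
    by (simp only: integral_Poisson_kernel[OF assms])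
  finally show ?thesis .
qed

text \<open>The integrals of \<open>- Im\<close> of the Cauchy transform over \<open>{c..d}\<close>
  are evaluated twice in the limit: under the \<open>x\<close>-integral they give
  \<open>pi * f\<close>, and after Tonelli the arctan differences tend to \<open>pi\<close> times
  the indicator of \<open>{c..d}\<close>. At \<open>c\<close> and \<open>d\<close> themselves the
  latter limit is \<open>pi / 2\<close>, so the endpoints must be null.\<close>

lemma Stieltjes_inversion:
  assumes cd: "c < d" and atoms: "measure M {c} = 0" "measure M {d} = 0"
    and lim: "\<And>x. x \<in> {c..d} \<Longrightarrow> (\<lambda>n. - Im (cauchy_transform M (Complex x (1 / real (Suc n))))) \<longlonglongrightarrow> pi * f x"
    and bnd: "\<And>x n. x \<in> {c..d} \<Longrightarrow> - Im (cauchy_transform M (Complex x (1 / real (Suc n)))) \<le> B"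
    and f: "f \<in> borel_measurable borel"
  shows "emeasure M {c..d} = (\<integral>\<^sup>+x. ennreal (f x) * indicator {c..d} x \<partial>lborel)"
proof -
  define u where "u n x = ennreal (- Im (cauchy_transform M (Complex x (1 / real (Suc n))))) * indicator {c..d} x" for n x
  define v where "v n s = ennreal (arctan ((d - s) / (1 / real (Suc n))) - arctan ((c - s) / (1 / real (Suc n))))" for n s
  have uv: "(\<integral>\<^sup>+x. u n x \<partial>lborel) = (\<integral>\<^sup>+s. v n s \<partial>M)" for n
    unfolding u_def v_def using cd by (intro nn_integral_Im_cauchy_transform) auto
  have meas: "(\<lambda>x. - Im (cauchy_transform M (Complex x y))) \<in> borel_measurable borel" if "0 < y" for y
  proof (rule borel_measurable_continuous_onI)
    have "continuous_on UNIV (\<lambda>x. Complex x y)"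
      by (intro continuous_intros)
    then show "continuous_on UNIV (\<lambda>x. - Im (cauchy_transform M (Complex x y)))"
      using that holomorphic_on_imp_continuous_on[OF cauchy_transform_holomorphic]
      by (intro continuous_intros continuous_on_compose2[of upper_half_plane _ UNIV "\<lambda>x. Complex x y"])
         (auto simp: upper_half_plane_def)
  qed
  have "(\<lambda>n. \<integral>\<^sup>+x. u n x \<partial>lborel) \<longlonglongrightarrow> (\<integral>\<^sup>+x. ennreal (pi * f x) * indicator {c..d} x \<partial>lborel)"
  proof (rule nn_integral_dominated_convergence[where w = "\<lambda>x. ennreal B * indicator {c..d} x"])
    show "u n \<in> borel_measurable lborel" for n
      unfolding u_def using meas[of "1 / real (Suc n)"] by measurable
    show "(\<integral>\<^sup>+x. ennreal B * indicator {c..d} x \<partial>lborel) < \<infinity>"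
      using emeasure_lborel_Icc[of c d] cd by (simp add: nn_integral_cmult_indicator ennreal_mult_less_top)
    show "AE x in lborel. u n x \<le> ennreal B * indicator {c..d} x" for n
      unfolding u_def using bnd by (intro AE_I2) (auto simp: indicator_def intro!: ennreal_leI)
    show "AE x in lborel. (\<lambda>n. u n x) \<longlonglongrightarrow> ennreal (pi * f x) * indicator {c..d} x"
    proof (intro AE_I2)
      fix x show "(\<lambda>n. u n x) \<longlonglongrightarrow> ennreal (pi * f x) * indicator {c..d} x"
        unfolding u_def using tendsto_ennrealI[OF lim, of x] by (cases "x \<in> {c..d}") auto
    qed
  qed (use f in measurable)
  moreover have "(\<lambda>n. \<integral>\<^sup>+s. v n s \<partial>M) \<longlonglongrightarrow> (\<integral>\<^sup>+s. ennreal pi * indicator {c..d} s \<partial>M)"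
  proof (rule nn_integral_dominated_convergence[where w = "\<lambda>s. ennreal pi"])
    show "(\<integral>\<^sup>+s. ennreal pi \<partial>M) < \<infinity>" by (simp add: emeasure_space_1[simplified])
    show "AE s in M. v n s \<le> ennreal pi" for n
    proof (intro AE_I2)
      fix s
      show "v n s \<le> ennreal pi"
        unfolding v_def using arctan_bounded[of "(d - s) / (1 / real (Suc n))"] arctan_bounded[of "(c - s) / (1 / real (Suc n))"]
        by (intro ennreal_leI) linarith
    qed
    have "AE s in M. s \<notin> {c}" "AE s in M. s \<notin> {d}"
      using atoms by (intro AE_not_in; simp add: null_sets_def emeasure_eq_measure)+
    then show "AE s in M. (\<lambda>n. v n s) \<longlonglongrightarrow> ennreal pi * indicator {c..d} s"
    proof eventually_elim
      case (elim s)
      have "(\<lambda>n. v n s) \<longlonglongrightarrow> ennreal (pi / 2 * sgn (d - s) - pi / 2 * sgn (c - s))"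
        unfolding v_def by (intro tendsto_ennrealI tendsto_diff tendsto_arctan_scaled)
      moreover have "ennreal (pi / 2 * sgn (d - s) - pi / 2 * sgn (c - s)) = ennreal pi * indicator {c..d} s"
        using elim cd by (auto simp: indicator_def sgn_if)
      ultimately show ?case by simp
    qed
  qed (unfold v_def, measurable)
  ultimately have "(\<integral>\<^sup>+x. ennreal (pi * f x) * indicator {c..d} x \<partial>lborel) = (\<integral>\<^sup>+s. ennreal pi * indicator {c..d} s \<partial>M)"
    unfolding uv by (rule LIMSEQ_unique)
  also have "(\<integral>\<^sup>+s. ennreal pi * indicator {c..d} s \<partial>M) = ennreal pi * emeasure M {c..d}"
    by (simp add: nn_integral_cmult_indicator)
  also have "(\<integral>\<^sup>+x. ennreal (pi * f x) * indicator {c..d} x \<partial>lborel) =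
      ennreal pi * (\<integral>\<^sup>+x. ennreal (f x) * indicator {c..d} x \<partial>lborel)"
    using f by (simp add: ennreal_mult' mult.assoc nn_integral_cmult)
  finally have e: "ennreal pi * (\<integral>\<^sup>+x. ennreal (f x) * indicator {c..d} x \<partial>lborel) = ennreal pi * emeasure M {c..d}" .
  then show ?thesis
    by (subst (asm) ennreal_mult_cancel_left) auto
qed

end

text \<open>Compact intervals inside \<open>U\<close> are the sets on which Stieltjes inversion
  applies. Here they are shown to generate the Borel sets of \<open>U\<close> and to cover it
  countably, rational endpoints giving countability.\<close>

lemma sigma_sets_Icc_subset:
  fixes U :: "real set"
  assumes "open U"
  shows "sets (restrict_space borel U) = sigma_sets U {{c..d} | c d. {c..d} \<subseteq> U}"
    (is "_ = sigma_sets U ?E")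
    and "\<exists>A. countable A \<and> A \<noteq> {} \<and> A \<subseteq> {{c..d} | c d. {c..d} \<subseteq> U} \<and> \<Union>A = U"
proof -
  define Q where "Q V = {{c..d} | c d. {c..d} \<subseteq> V \<and> c \<in> \<rat> \<and> d \<in> \<rat>}" for V :: "real set"
  have Q: "countable (Q V)" for V
  proof (rule countable_subset)
    show "Q V \<subseteq> (\<lambda>(c, d). {c..d}) ` (\<rat> \<times> \<rat>)" by (auto simp: Q_def)
    show "countable ((\<lambda>(c, d). {c..d} :: real set) ` (\<rat> \<times> \<rat>))"
      by (intro countable_image countable_SIGMA countable_rat)
  qed
  have UQ: "\<Union>(Q V) = V" if "open V" for V
  proof
    show "V \<subseteq> \<Union>(Q V)"
    proof
      fix x assume "x \<in> V"
      then obtain e where e: "0 < e" "ball x e \<subseteq> V" using \<open>open V\<close> openE by blast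
      obtain c where c: "c \<in> \<rat>" "x - e < c" "c < x" using Rats_dense_in_real[of "x - e" x] e(1) by auto
      obtain d where d: "d \<in> \<rat>" "x < d" "d < x + e" using Rats_dense_in_real[of x "x + e"] e(1) by auto
      have "{c..d} \<subseteq> V" using e(2) c d by (auto simp: dist_real_def subset_iff)
      then have "{c..d} \<in> Q V" using c d by (auto simp: Q_def)
      then show "x \<in> \<Union>(Q V)" using c d by (intro UnionI[of "{c..d}"]) auto
    qed
  qed (auto simp: Q_def)
  have QE: "Q V \<subseteq> ?E" if "V \<subseteq> U" for V using that by (auto simp: Q_def)
  \<comment> \<open>The reversed endpoints 1 and 0 give the empty interval, so the cover is a
    nonempty family even for empty \<open>U\<close>.\<close>
  have "{} \<in> Q U" unfolding Q_def
    by (rule CollectI, rule exI[of _ 1], rule exI[of _ 0]) auto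
  then show "\<exists>A. countable A \<and> A \<noteq> {} \<and> A \<subseteq> ?E \<and> \<Union>A = U"
    using Q[of U] UQ[OF assms] QE[of U] by (intro exI[of _ "Q U"]) auto
  show "sets (restrict_space borel U) = sigma_sets U ?E"
  proof
    have "U \<in> sigma_sets UNIV (Collect open)" using assms by (auto intro: sigma_sets.Basic)
    then have "sets (restrict_space borel U) = sigma_sets U ((\<inter>) U ` Collect open)"
      unfolding sets_restrict_space borel_def by (simp add: sigma_sets_Int)
    also have "\<dots> \<subseteq> sigma_sets U ?E"
    proof (rule sigma_sets_mono, safe)
      fix V :: "real set" assume "open V"
      then have o: "open (U \<inter> V)" using assms by auto
      have "\<Union>(Q (U \<inter> V)) \<in> sigma_sets U ?E"
        by (rule sigma_sets_UNION[OF Q]) (use QE[of "U \<inter> V"] in \<open>auto intro: sigma_sets.Basic\<close>)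
      then show "U \<inter> V \<in> sigma_sets U ?E" by (simp add: UQ[OF o])
    qed
    finally show "sets (restrict_space borel U) \<subseteq> sigma_sets U ?E" .
    show "sigma_sets U ?E \<subseteq> sets (restrict_space borel U)"
    proof -
      have "?E \<subseteq> sets (restrict_space borel U)"
      proof safe
        fix c d :: real assume "{c..d} \<subseteq> U"
        then have "{c..d} = U \<inter> {c..d}" by auto
        then show "{c..d} \<in> sets (restrict_space borel U)" unfolding sets_restrict_space by auto
      qed
      from sets.sigma_sets_subset[OF this] show ?thesis by (simp add: space_restrict_space)
    qed
  qed
qed

section \<open>Free convolution powers\<close>

text \<open>For \<open>w = h' v\<close> the relation between the Voiculescu transforms says
  \<open>om w = h v\<close>, and both sides of the identity equal \<open>v\<close>. The points
  \<open>h' v\<close> fill a nonempty open set, so the identity theorem extends this to the half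
  plane.\<close>

lemma free_convolution_power_subordination:
  assumes \<mu>: "real_distribution \<mu>" and t: "1 < t" and conv: "free_convolution_power \<mu> t \<nu>"
    and z: "z \<in> upper_half_plane"
  shows "F_transform \<nu> z = F_transform \<mu> ((z + (t - 1) * F_transform \<nu> z) / t)"
proof -
  interpret mu: real_distribution \<mu> by (rule \<mu>)
  interpret nu: real_distribution \<nu> using conv by (simp add: free_convolution_power_def)
  define om where "om z = (z + (t - 1) * F_transform \<nu> z) / t" for z
  obtain \<beta> h \<beta>' h' where h: "F_right_inverse \<mu> \<beta> h" and h': "F_right_inverse \<nu> \<beta>' h'"
    and hh: "\<And>z. z \<in> inverse_domain \<beta> \<inter> inverse_domain \<beta>' \<Longrightarrow> h' z - z = complex_of_real t * (h z - z)"
    using conv unfolding free_convolution_power_def voiculescu_transform_def by (metis IntD1 IntD2)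
  define B where "B = max 0 (max (\<beta> 1) (\<beta>' 1))"
  \<comment> \<open>The part of the cone of aperture 1 lying above the thresholds of both
    domains.\<close>
  define V where "V = {z. \<bar>Re z\<bar> < Im z} \<inter> {z. B < Im z}"
  have oV: "open V"
    unfolding V_def by (intro open_Int open_Collect_less continuous_intros)
  have V: "V \<subseteq> inverse_domain \<beta> \<inter> inverse_domain \<beta>'"
  proof
    fix z assume "z \<in> V"
    then have "z \<in> cone 1" "\<beta> 1 < Im z" "\<beta>' 1 < Im z"
      by (auto simp: V_def B_def cone_def upper_half_plane_def)
    then show "z \<in> inverse_domain \<beta> \<inter> inverse_domain \<beta>'"
      unfolding inverse_domain_def by (auto intro!: bexI[of _ 1])
  qed
  have "\<i> * of_real (B + 1) \<in> V" by (auto simp: V_def B_def)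
  then have Vne: "V \<noteq> {}" by blast
  have hV: "h z \<in> upper_half_plane" "F_transform \<mu> (h z) = z" "h' z \<in> upper_half_plane" "F_transform \<nu> (h' z) = z"
      "h' z - z = t * (h z - z)" if "z \<in> V" for z
    using h h' hh[of z] V that unfolding F_right_inverse_def by auto
  \<comment> \<open>\<open>F_transform \<nu>\<close> is a left inverse of \<open>h'\<close>, and an
    injective holomorphic map has open image.\<close>
  have "inj_on h' V" by (rule inj_onI) (metis hV(4))
  moreover have "h' holomorphic_on V"
    using h' V unfolding F_right_inverse_def by (auto intro: holomorphic_on_subset)
  ultimately have oS: "open (h' ` V)" using open_mapping_thm3 oV by blast
  have omU: "om z \<in> upper_half_plane" if "z \<in> upper_half_plane" for z
    using nu.Im_F_transform_ge[of z] that t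
    by (auto simp: om_def upper_half_plane_def intro!: divide_pos_pos add_pos_nonneg)
  have omh: "om holomorphic_on upper_half_plane"
    unfolding om_def using t by (intro holomorphic_intros nu.F_transform_holomorphic) auto
  have hol: "(\<lambda>z. F_transform \<mu> (om z)) holomorphic_on upper_half_plane"
    using holomorphic_on_compose[OF omh holomorphic_on_subset[OF mu.F_transform_holomorphic]] omU
    by (auto simp: o_def)
  have "F_transform \<nu> w = F_transform \<mu> (om w)" if w: "w \<in> h' ` V" for w
  proof -
    obtain v where v: "v \<in> V" "w = h' v" using w by auto
    have "om w = h v"
      using hV(5)[OF v(1)] t unfolding om_def v(2) hV(4)[OF v(1)] by (simp add: field_simps)
    then show ?thesis using hV[OF v(1)] v(2) by simp
  qed
  moreover have "h' ` V \<noteq> {}" "h' ` V \<subseteq> upper_half_plane" using Vne hV(3) by auto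
  ultimately have "F_transform \<nu> z = F_transform \<mu> (om z)"
    using analytic_continuation_open[OF oS open_upper_half_plane _ connected_upper_half_plane _
        nu.F_transform_holomorphic hol _ z] by simp
  then show ?thesis by (simp add: om_def)
qed

text \<open>From the convolution power only the subordination identity is retained; the boundary
  theory enters through the sublocale that follows.\<close>

locale free_power =
  mu: real_distribution \<mu> + nu: real_distribution \<nu> for \<mu> \<nu> :: "real measure" +
  fixes t :: real
  assumes t: "1 < t"
    and subordinate: "z \<in> upper_half_plane \<Longrightarrow>
      F_transform \<nu> z = F_transform \<mu> ((z + (t - 1) * F_transform \<nu> z) / t)"
begin

sublocale subordination "\<lambda>w. F_transform \<mu> w - w" "\<lambda>z. (z + (t - 1) * F_transform \<nu> z) / t" "t - 1"
proof
  let ?\<omega> = "\<lambda>z. (z + (t - 1) * F_transform \<nu> z) / t"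
  show "(\<lambda>w. F_transform \<mu> w - w) holomorphic_on upper_half_plane"
    by (intro holomorphic_intros mu.F_transform_holomorphic)
  show "0 \<le> Im (F_transform \<mu> w - w)" if "w \<in> upper_half_plane" for w
    using mu.Im_F_transform_ge[of w] that by (simp add: upper_half_plane_def)
  show "continuous_on upper_half_plane ?\<omega>"
    using t by (intro continuous_intros holomorphic_on_imp_continuous_on nu.F_transform_holomorphic) auto
  show "?\<omega> z \<in> upper_half_plane" if "z \<in> upper_half_plane" for z
    using nu.Im_F_transform_ge[of z] that t
    by (auto simp: upper_half_plane_def intro!: divide_pos_pos add_pos_nonneg)
  show "?\<omega> z - complex_of_real (t - 1) * (F_transform \<mu> (?\<omega> z) - ?\<omega> z) = z" if "z \<in> upper_half_plane" for z
    unfolding subordinate[OF that, symmetric] using t by (simp add: field_simps)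
qed (use t in simp)

section \<open>Boundary values of the subordination function and of
  \<open>F_transform \<nu>\<close>\<close>

abbreviation om :: "complex \<Rightarrow> complex" where "om z \<equiv> (z + (t - 1) * F_transform \<nu> z) / t"

abbreviation b :: "real \<Rightarrow> complex" where "b \<equiv> F_boundary \<nu>"

text \<open>\<open>F_transform \<nu> z = (t * om z - z) / (t - 1)\<close>, so the limit of the
  subordination function carries over.\<close>

lemma F_boundary_limit:
  shows F_limit: "(F_transform \<nu> \<longlongrightarrow> b x) (at (of_real x) within upper_half_plane)"
    and om_limit: "(om \<longlongrightarrow> (x + (t - 1) * b x) / t) (at (of_real x) within upper_half_plane)"
    and om_cluster: "cluster x ((x + (t - 1) * b x) / t)"
proof -
  obtain l where l: "(om \<longlongrightarrow> l) (at (of_real x) within upper_half_plane)" "cluster x l"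
    using \<omega>_limit by blast
  have "((\<lambda>z. (t * om z - z) / (t - 1)) \<longlongrightarrow> (t * l - x) / (t - 1)) (at (of_real x) within upper_half_plane)"
    using t by (intro tendsto_intros l) auto
  moreover have "(t * om z - z) / (t - 1) = F_transform \<nu> z" for z
    using t by (simp add: field_simps)
  ultimately have F: "(F_transform \<nu> \<longlongrightarrow> (t * l - x) / (t - 1)) (at (of_real x) within upper_half_plane)"
    by simp
  then have bx: "b x = (t * l - x) / (t - 1)"
    unfolding F_boundary_def by (rule tendsto_Lim[OF at_within_upper_half_plane_nontrivial])
  show "(F_transform \<nu> \<longlongrightarrow> b x) (at (of_real x) within upper_half_plane)" using F bx by simp
  have "l = (x + (t - 1) * b x) / t" using t unfolding bx by (simp add: field_simps)
  with l show "(om \<longlongrightarrow> (x + (t - 1) * b x) / t) (at (of_real x) within upper_half_plane)"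
    "cluster x ((x + (t - 1) * b x) / t)" by auto
qed

section \<open>Zeros of the boundary function and atoms\<close>

lemma F_boundary_zero_imp_atom:
  assumes "b x = 0" shows "(t - 1) / t \<le> measure \<mu> {x / t}"
proof -
  define a where "a = x / t"
  define z where "z n = Complex a (1 / real (Suc n))" for n
  have cl: "cluster x (of_real a)" using om_cluster[of x] assms by (simp add: a_def)
  have Im: "0 < Im (z n)" for n by (simp add: z_def)
  have za: "z n - of_real a = \<i> * of_real (1 / real (Suc n))" for n by (simp add: z_def complex_eq_iff)
  have "(\<lambda>n. z n) \<longlonglongrightarrow> Complex a 0"
    unfolding z_def by (intro tendsto_intros LIMSEQ_Suc[OF lim_1_over_n])
  then have "z \<longlonglongrightarrow> of_real a" by (simp add: complex_of_real_def)
  then have lim: "(\<lambda>n. (z n - of_real a) * cauchy_transform \<mu> (z n)) \<longlonglongrightarrow> of_real (measure \<mu> {a})"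
    by (rule mu.cauchy_transform_atom[OF Im, where C = 1]) (unfold za norm_mult norm_of_real, simp add: z_def)
  have "(t - 1) / t \<le> cmod ((z n - of_real a) * cauchy_transform \<mu> (z n))" for n
  proof -
    define y where "y = 1 / real (Suc n)"
    have y: "0 < y" by (simp add: y_def)
    \<comment> \<open>Since \<open>x = t * a\<close>, the vertical limit of
      \<open>F_transform \<mu> w - w\<close> at \<open>a\<close> is \<open>- a\<close>. Thus
      \<open>F_transform \<mu>\<close> vanishes at \<open>a\<close> at a linear rate, which bounds
      the mass of \<open>a\<close> from below.\<close>
    have ax: "(a - x) / (t - 1) = - a" using t by (simp add: a_def field_simps)
    have D: "cmod (F_transform \<mu> (z n) - z n + a) \<le> y / (t - 1)"
      using cluster_real_vertical[OF cl y] by (simp add: z_def y_def ax)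
    have zy: "cmod (z n - a) = y" unfolding za norm_mult norm_of_real by (simp add: y_def)
    have "F_transform \<mu> (z n) = (F_transform \<mu> (z n) - z n + a) + (z n - a)" by simp
    then have "cmod (F_transform \<mu> (z n)) \<le> cmod (F_transform \<mu> (z n) - z n + a) + cmod (z n - a)"
      by (metis norm_triangle_ineq)
    also have "\<dots> \<le> y / (t - 1) + y" using D zy by linarith
    also have "\<dots> = y * t / (t - 1)" using t by (simp add: field_simps)
    finally have F: "cmod (F_transform \<mu> (z n)) \<le> y * t / (t - 1)" .
    have F0: "0 < cmod (F_transform \<mu> (z n))"
      using mu.cauchy_transform_nonzero[OF Im[of n]] by (simp add: F_transform_def)
    have "(t - 1) / t = y / (y * t / (t - 1))" using t y by simp
    also have "\<dots> \<le> y / cmod (F_transform \<mu> (z n))"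
      using F F0 y t by (intro divide_left_mono mult_pos_pos) auto
    also have "\<dots> = cmod ((z n - of_real a) * cauchy_transform \<mu> (z n))"
      unfolding za norm_mult norm_of_real F_transform_def norm_divide using y by (simp add: y_def)
    finally show ?thesis .
  qed
  then have "(t - 1) / t \<le> cmod (of_real (measure \<mu> {a}))"
    by (intro LIMSEQ_le_const[OF tendsto_norm[OF lim]]) auto
  then show ?thesis by (simp add: a_def)
qed

text \<open>With enough mass at \<open>a\<close>, the vertical line above \<open>a\<close> lies
  where \<open>Im H\<close> is positive, so it is the image under \<open>om\<close> of the points
  \<open>H (z n)\<close>, which tend to \<open>t * a\<close>. This carries information on \<mu> at
  \<open>a\<close> over to \<nu> at \<open>t * a\<close>.\<close>

lemma atom_approach:
  fixes z :: "nat \<Rightarrow> complex"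
  assumes m: "(t - 1) / t \<le> measure \<mu> {a}"
    and z_def: "z = (\<lambda>n. Complex a (1 / real (Suc n)))"
  shows "0 < Im (H (z n))" and "om (H (z n)) = z n"
    and "(\<lambda>n. H (z n)) \<longlonglongrightarrow> of_real (t * a)"
    and "(\<lambda>n. (z n - of_real a) * cauchy_transform \<mu> (z n)) \<longlonglongrightarrow> of_real (measure \<mu> {a})"
    and "z \<longlonglongrightarrow> of_real a"
    and "H (z n) - of_real (t * a) = t * (z n - of_real a) - (t - 1) * F_transform \<mu> (z n)"
proof -
  have m0: "0 < measure \<mu> {a}" using m t by (intro less_le_trans[OF _ m]) auto
  have Im: "0 < Im (z n)" for n by (simp add: z_def)
  have za: "z n - of_real a = \<i> * of_real (1 / real (Suc n))" for n by (simp add: z_def complex_eq_iff)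
  have "(\<lambda>n. z n) \<longlonglongrightarrow> Complex a 0"
    unfolding z_def by (intro tendsto_intros LIMSEQ_Suc[OF lim_1_over_n])
  then show z: "z \<longlonglongrightarrow> of_real a" by (simp add: complex_of_real_def)
  then show lim: "(\<lambda>n. (z n - of_real a) * cauchy_transform \<mu> (z n)) \<longlonglongrightarrow> of_real (measure \<mu> {a})"
    by (rule mu.cauchy_transform_atom[OF Im, where C = 1]) (unfold za norm_mult norm_of_real, simp add: z_def)
  have Hz: "H w = t * w - (t - 1) * F_transform \<mu> w" for w :: complex by (simp add: H_def algebra_simps)
  show H: "H (z n) - of_real (t * a) = t * (z n - of_real a) - (t - 1) * F_transform \<mu> (z n)" for n
    unfolding Hz by (simp add: algebra_simps)
  show pos: "0 < Im (H (z n))" for n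
  proof -
    define y where "y = 1 / real (Suc n)"
    have y: "0 < y" by (simp add: y_def)
    have le: "y / measure \<mu> {a} \<le> y * t / (t - 1)"
    proof -
      have "y / measure \<mu> {a} \<le> y / ((t - 1) / t)" using m m0 y t by (intro divide_left_mono mult_pos_pos) auto
      then show ?thesis by simp
    qed
    \<comment> \<open>Strictness comes from the mass outside \<open>a\<close> when there is some,
      and from \<open>t / (t - 1) > 1\<close> when \<mu> is a point mass.\<close>
    have "Im (F_transform \<mu> (Complex a y)) < y * t / (t - 1)"
    proof (cases "measure \<mu> {a} < 1")
      case True
      then show ?thesis using mu.F_transform_above_atom(2)[OF m0 y True] le by linarith
    next
      case False
      then have "measure \<mu> {a} = 1" using mu.prob_le_1[of "{a}"] by linarith
      then have "Im (F_transform \<mu> (Complex a y)) \<le> y"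
        using mu.F_transform_above_atom(1)[OF m0 y] abs_Im_le_cmod[of "F_transform \<mu> (Complex a y)"] by simp
      also have "y < y * t / (t - 1)" using y t by (simp add: field_simps)
      finally show ?thesis .
    qed
    then have "(t - 1) * Im (F_transform \<mu> (Complex a y)) < t * y" using t by (simp add: field_simps)
    then show ?thesis by (simp add: Hz z_def y_def)
  qed
  show "om (H (z n)) = z n"
    by (rule \<omega>_H[OF _ pos]) (use Im in \<open>simp add: upper_half_plane_def\<close>)
  have G0: "cauchy_transform \<mu> (z n) \<noteq> 0" for n using mu.cauchy_transform_nonzero[OF Im] .
  have "(\<lambda>n. (z n - of_real a) / ((z n - of_real a) * cauchy_transform \<mu> (z n))) \<longlonglongrightarrow> (of_real a - of_real a) / of_real (measure \<mu> {a})"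
    using m0 by (intro tendsto_intros z lim) auto
  moreover have "(z n - of_real a) / ((z n - of_real a) * cauchy_transform \<mu> (z n)) = F_transform \<mu> (z n)" for n
    using G0[of n] Im[of n] by (auto simp: F_transform_def)
  ultimately have F: "(\<lambda>n. F_transform \<mu> (z n)) \<longlonglongrightarrow> 0" by simp
  have "(\<lambda>n. t * z n - (t - 1) * F_transform \<mu> (z n)) \<longlonglongrightarrow> t * complex_of_real a - of_real (t - 1) * 0"
    by (intro tendsto_intros z F)
  then show "(\<lambda>n. H (z n)) \<longlonglongrightarrow> of_real (t * a)" by (simp add: Hz)
qed

text \<open>Along \<open>H (z n)\<close>, which tends to \<open>x\<close>, the subordination
  function tends to \<open>x / t\<close>. Uniqueness of the cluster value leaves no room for a
  nonzero \<open>b x\<close>.\<close>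

lemma atom_imp_F_boundary_zero:
  assumes m: "(t - 1) / t \<le> measure \<mu> {x / t}" shows "b x = 0"
proof -
  define z where "z = (\<lambda>n. Complex (x / t) (1 / real (Suc n)))"
  note A = atom_approach[OF m z_def]
  have "cluster x (of_real (x / t))"
    unfolding cluster_def using A t
    by (intro exI[of _ "\<lambda>n. H (z n)"]) (simp add: upper_half_plane_def)
  then have "(x + (t - 1) * b x) / t = of_real (x / t)" by (rule cluster_unique[OF om_cluster])
  then show ?thesis using t by simp
qed

text \<open>The mass of \<open>x\<close> under \<nu> is computed along \<open>H (z n)\<close>, where
  the Cauchy transform of \<nu> equals that of \<mu> at \<open>z n\<close>. The strict threshold
  makes this approach nontangential.\<close>

lemma measure_atom:
  assumes m: "(t - 1) / t < measure \<mu> {x / t}"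
  shows "measure \<nu> {x} = t * measure \<mu> {x / t} - (t - 1)"
proof -
  define a where "a = x / t"
  define p where "p = measure \<mu> {a}"
  define z where "z = (\<lambda>n. Complex a (1 / real (Suc n)))"
  have m': "(t - 1) / t < p" using m by (simp add: a_def p_def)
  have p0: "0 < p" using m' t by (intro less_trans[OF _ m']) auto
  note A = atom_approach[OF order.strict_implies_order[OF m'[unfolded p_def]] z_def]
  have x: "t * a = x" using t by (simp add: a_def)
  \<comment> \<open>\<open>\<kappa> * y\<close> bounds \<open>Im (H (z n))\<close> from below at
    height \<open>y\<close>; \<open>\<kappa> > 0\<close> is the strict threshold rewritten.\<close>
  define \<kappa> where "\<kappa> = t - (t - 1) / p"
  have \<kappa>: "0 < \<kappa>" using m' p0 t by (simp add: \<kappa>_def field_simps)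
  have cone: "cmod (H (z n) - of_real x) \<le> (t + (t - 1) / p) / \<kappa> * Im (H (z n))" for n
  proof -
    define y where "y = 1 / real (Suc n)"
    have y: "0 < y" by (simp add: y_def)
    have za: "z n - of_real a = \<i> * of_real y" by (simp add: z_def y_def complex_eq_iff)
    have F: "cmod (F_transform \<mu> (z n)) \<le> y / p"
      using mu.F_transform_above_atom(1)[OF p0[unfolded p_def] y] by (simp add: z_def y_def p_def)
    have "cmod (H (z n) - of_real x) \<le> cmod (t * (z n - of_real a)) + cmod ((t - 1) * F_transform \<mu> (z n))"
      unfolding A(6)[unfolded x] by (rule norm_triangle_ineq4)
    also have "cmod (t * (z n - of_real a)) = t * y"
      unfolding za norm_mult norm_of_real using t y by simp
    also have "cmod ((t - 1) * F_transform \<mu> (z n)) = (t - 1) * cmod (F_transform \<mu> (z n))"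
      unfolding norm_mult norm_of_real using t by simp
    also have "(t - 1) * cmod (F_transform \<mu> (z n)) \<le> (t - 1) * (y / p)" using F t by (intro mult_left_mono) auto
    also have "t * y + (t - 1) * (y / p) = (t + (t - 1) / p) * y" by (simp add: algebra_simps)
    finally have 1: "cmod (H (z n) - of_real x) \<le> (t + (t - 1) / p) * y" by simp
    have "Im (H (z n)) = Im (H (z n) - of_real x)" by simp
    also have "\<dots> = t * y - (t - 1) * Im (F_transform \<mu> (z n))" unfolding A(6)[unfolded x] za by simp
    finally have 2: "Im (H (z n)) = t * y - (t - 1) * Im (F_transform \<mu> (z n))" .
    have "Im (F_transform \<mu> (z n)) \<le> y / p" using F abs_Im_le_cmod[of "F_transform \<mu> (z n)"] by linarith
    then have "(t - 1) * Im (F_transform \<mu> (z n)) \<le> (t - 1) * (y / p)" using t by (intro mult_left_mono) auto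
    then have "\<kappa> * y \<le> Im (H (z n))" unfolding 2 by (simp add: \<kappa>_def algebra_simps)
    then have "y \<le> Im (H (z n)) / \<kappa>" using \<kappa> by (simp add: field_simps)
    then have "(t + (t - 1) / p) * y \<le> (t + (t - 1) / p) * (Im (H (z n)) / \<kappa>)"
      using t p0 by (intro mult_left_mono add_nonneg_nonneg) auto
    with 1 show ?thesis by simp
  qed
  have "(\<lambda>n. (H (z n) - of_real x) * cauchy_transform \<nu> (H (z n))) \<longlonglongrightarrow> of_real (measure \<nu> {x})"
    using A(3)[unfolded x] by (rule nu.cauchy_transform_atom[OF A(1) _ cone])
  moreover have "(H (z n) - of_real x) * cauchy_transform \<nu> (H (z n)) =
      t * ((z n - of_real a) * cauchy_transform \<mu> (z n)) - (t - 1)" for n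
  proof -
    have "F_transform \<nu> (H (z n)) = F_transform \<mu> (z n)"
      using subordinate[of "H (z n)"] A(1)[of n] unfolding A(2) by (simp add: upper_half_plane_def)
    then have "cauchy_transform \<nu> (H (z n)) = cauchy_transform \<mu> (z n)" by (simp add: F_transform_def)
    moreover have "F_transform \<mu> (z n) * cauchy_transform \<mu> (z n) = 1"
      using mu.cauchy_transform_nonzero[of "z n"] by (simp add: F_transform_def z_def)
    ultimately show ?thesis unfolding A(6)[unfolded x]
      by (simp add: left_diff_distrib mult.assoc)
  qed
  moreover have "(\<lambda>n. t * ((z n - of_real a) * cauchy_transform \<mu> (z n)) - (t - 1)) \<longlonglongrightarrow> t * complex_of_real p - (t - 1)"
    using A(4) unfolding p_def by (intro tendsto_intros)
  ultimately have "complex_of_real (measure \<nu> {x}) = of_real (t * p - (t - 1))"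
    using LIMSEQ_unique by fastforce
  then show ?thesis unfolding of_real_eq_iff by (simp add: p_def a_def)
qed

lemma F_boundary_zero_iff: "b x = 0 \<longleftrightarrow> x / t \<in> atoms \<mu> \<and> (t - 1) / t \<le> measure \<mu> {x / t}"
proof -
  have "0 < (t - 1) / t" using t by simp
  then show ?thesis
    using F_boundary_zero_imp_atom[of x] atom_imp_F_boundary_zero[of x] by (auto simp: atoms_def)
qed

text \<open>Total mass 1 leaves room for at most \<open>t / (t - 1)\<close> atoms of mass at least
  \<open>(t - 1) / t\<close>.\<close>

lemma finite_F_boundary_zero: "finite {x. b x = 0}"
proof -
  let ?e = "(t - 1) / t"
  let ?A = "{a. ?e \<le> measure \<mu> {a}}"
  have e: "0 < ?e" using t by simp
  have "card G \<le> nat \<lfloor>1 / ?e\<rfloor>" if G: "G \<subseteq> ?A" "finite G" for G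
  proof -
    have "real (card G) * ?e \<le> (\<Sum>a\<in>G. measure \<mu> {a})"
      using sum_mono[of G "\<lambda>_. ?e" "\<lambda>a. measure \<mu> {a}"] G by auto
    also have "\<dots> = measure \<mu> G"
      by (rule mu.finite_measure_eq_sum_singleton[symmetric]) (use G in auto)
    also have "\<dots> \<le> 1" by simp
    finally have "real (card G) \<le> 1 / ?e" by (subst pos_le_divide_eq[OF e])
    then show ?thesis by (simp add: le_nat_floor)
  qed
  then have "finite ?A" using finite_if_finite_subsets_card_bdd[of ?A] by blast
  then have "finite ((\<lambda>a. t * a) ` ?A)" by simp
  moreover have "{x. b x = 0} \<subseteq> (\<lambda>a. t * a) ` ?A"
    using F_boundary_zero_iff t by (force intro!: image_eqI[of _ _ "_ / t"])
  ultimately show ?thesis by (rule rev_finite_subset)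
qed

text \<open>Division by zero makes the density vanish at the zeros of the boundary function.\<close>

definition boundary_density :: "real \<Rightarrow> real" where "boundary_density x = - Im (1 / b x) / pi"

lemma boundary_density_altdef: "boundary_density x = Im (b x) / ((cmod (b x))\<^sup>2 * pi)"
  by (simp add: boundary_density_def Im_divide')

section \<open>Sign and continuity of the boundary density\<close>

lemma Im_F_boundary_nonneg: "0 \<le> Im (b x)"
proof (rule tendsto_lowerbound[OF tendsto_Im[OF F_limit[of x]]])
  show "eventually (\<lambda>z. 0 \<le> Im (F_transform \<nu> z)) (at (of_real x) within upper_half_plane)"
    unfolding eventually_at_filter
    by (intro always_eventually) (use nu.Im_F_transform_ge in \<open>force simp: upper_half_plane_def\<close>)
qed (rule at_within_upper_half_plane_nontrivial)

lemma boundary_density_nonneg: "0 \<le> boundary_density x"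
  using Im_F_boundary_nonneg[of x] by (simp add: boundary_density_altdef)

definition Fext :: "complex \<Rightarrow> complex" where
  "Fext z = (if 0 < Im z then F_transform \<nu> z else b (Re z))"

lemma continuous_on_Fext: "continuous_on {z. 0 \<le> Im z} Fext"
  unfolding Fext_def[abs_def]
  by (rule continuous_on_boundary_extension)
     (auto intro: holomorphic_on_imp_continuous_on nu.F_transform_holomorphic F_limit)

lemma isCont_F_boundary: "isCont b x"
proof -
  have "continuous_on UNIV (\<lambda>x. Fext (of_real x))"
    by (rule continuous_on_compose2[OF continuous_on_Fext]) (auto intro!: continuous_intros)
  then have "continuous_on UNIV b" by (simp add: Fext_def)
  then show ?thesis by (simp add: continuous_on_eq_continuous_at)
qed

lemma isCont_boundary_density: "b x \<noteq> 0 \<Longrightarrow> isCont boundary_density x"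
  unfolding boundary_density_def[abs_def]
  by (intro isCont_divide isCont_minus isCont_Im isCont_F_boundary continuous_const) auto

lemma boundary_density_measurable: "boundary_density \<in> borel_measurable borel"
proof -
  have "continuous_on UNIV b"
    using isCont_F_boundary by (simp add: continuous_at_imp_continuous_on)
  then have [measurable]: "b \<in> borel_measurable borel" by (rule borel_measurable_continuous_onI)
  show ?thesis unfolding boundary_density_def[abs_def] by measurable
qed

section \<open>Identification of the nonatomic part\<close>

lemma cauchy_transform_vertical_limit:
  "b x \<noteq> 0 \<Longrightarrow> (\<lambda>n. cauchy_transform \<nu> (Complex x (1 / real (Suc n)))) \<longlonglongrightarrow> 1 / b x"
proof -
  assume bx: "b x \<noteq> 0"
  have "(\<lambda>n. Complex x (1 / real (Suc n))) \<longlonglongrightarrow> Complex x 0"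
    by (intro tendsto_intros LIMSEQ_Suc[OF lim_1_over_n])
  then have "filterlim (\<lambda>n. Complex x (1 / real (Suc n))) (at (of_real x) within upper_half_plane) sequentially"
    by (intro filterlim_at[THEN iffD2] conjI always_eventually allI)
       (auto simp: upper_half_plane_def complex_of_real_def)
  from filterlim_compose[OF F_limit this]
  have "(\<lambda>n. 1 / F_transform \<nu> (Complex x (1 / real (Suc n)))) \<longlonglongrightarrow> 1 / b x"
    using bx by (intro tendsto_intros)
  then show ?thesis by (simp add: F_transform_def)
qed

text \<open>The Cauchy transform has the finite vertical limit \<open>1 / b x\<close>, so
  multiplying it by \<open>z n - x\<close> gives limit 0.\<close>

lemma no_atom:
  assumes "b x \<noteq> 0" shows "measure \<nu> {x} = 0"
proof -
  define z where "z n = Complex x (1 / real (Suc n))" for n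
  have zx: "z n - of_real x = \<i> * of_real (1 / real (Suc n))" for n by (simp add: z_def complex_eq_iff)
  have "(\<lambda>n. z n) \<longlonglongrightarrow> Complex x 0"
    unfolding z_def by (intro tendsto_intros LIMSEQ_Suc[OF lim_1_over_n])
  then have z: "z \<longlonglongrightarrow> of_real x" by (simp add: complex_of_real_def)
  then have "(\<lambda>n. (z n - of_real x) * cauchy_transform \<nu> (z n)) \<longlonglongrightarrow> of_real (measure \<nu> {x})"
    by (rule nu.cauchy_transform_atom[OF _ _, where C = 1, rotated]) (unfold zx norm_mult norm_of_real, simp_all add: z_def)
  moreover have "(\<lambda>n. (z n - of_real x) * cauchy_transform \<nu> (z n)) \<longlonglongrightarrow> (of_real x - of_real x) * (1 / b x)"
    using cauchy_transform_vertical_limit[OF assms] by (intro tendsto_intros z) (simp add: z_def)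
  ultimately have "complex_of_real (measure \<nu> {x}) = (of_real x - of_real x) * (1 / b x)" by (rule LIMSEQ_unique)
  then show ?thesis by simp
qed

lemma atoms_subset: "atoms \<nu> \<subseteq> {x. b x = 0}"
  using no_atom by (force simp: atoms_def)

lemma emeasure_Icc:
  assumes cd: "{c..d} \<subseteq> {x. b x \<noteq> 0}"
  shows "emeasure \<nu> {c..d} = (\<integral>\<^sup>+x. ennreal (boundary_density x) * indicator {c..d} x \<partial>lborel)"
proof -
  consider "d < c" | "c = d" | "c < d" by linarith
  then show ?thesis
  proof cases
    case 2
    have "AE x in lborel. ennreal (boundary_density x) * indicator {d} x = 0"
      using AE_lborel_singleton[of d] by (auto elim!: eventually_mono)
    then have "(\<integral>\<^sup>+x. ennreal (boundary_density x) * indicator {d} x \<partial>lborel) = 0"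
      using boundary_density_measurable by (subst nn_integral_0_iff_AE) auto
    then show ?thesis using no_atom[of d] cd by (simp add: 2 nu.emeasure_eq_measure)
  next
    case 3
    \<comment> \<open>Height 1 is enough to contain all points
      \<open>Complex x (1 / real (Suc n))\<close>. Compactness of this rectangle gives the uniform
      bound required for Stieltjes inversion.\<close>
    define K where "K = cbox (Complex c 0) (Complex d 1)"
    have K: "K \<subseteq> {z. 0 \<le> Im z}" by (auto simp: K_def in_cbox_complex_iff)
    have F0: "Fext z \<noteq> 0" if "z \<in> K" for z
    proof (cases "0 < Im z")
      case True
      then show ?thesis using nu.Im_F_transform_ge[OF True] by (auto simp: Fext_def)
    next
      case False
      have "Re z \<in> {c..d}" using that by (auto simp: K_def in_cbox_complex_iff)
      then show ?thesis using cd False by (auto simp: Fext_def)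
    qed
    have "continuous_on K (\<lambda>z. 1 / Fext z)"
      using F0 by (intro continuous_intros continuous_on_subset[OF continuous_on_Fext K]) auto
    then have "compact ((\<lambda>z. 1 / Fext z) ` K)" by (rule compact_continuous_image) (simp add: K_def)
    then have "\<exists>B. \<forall>z\<in>K. cmod (1 / Fext z) \<le> B"
      by (auto dest!: compact_imp_bounded simp: bounded_iff)
    then obtain B where B: "\<And>z. z \<in> K \<Longrightarrow> cmod (1 / Fext z) \<le> B" by blast
    show ?thesis
    proof (rule nu.Stieltjes_inversion[OF 3])
      show "measure \<nu> {c} = 0" "measure \<nu> {d} = 0" using no_atom subsetD[OF cd, of c] subsetD[OF cd, of d] 3 by auto
      show "boundary_density \<in> borel_measurable borel" by (rule boundary_density_measurable)
      fix x assume x: "x \<in> {c..d}"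
      then have bx: "b x \<noteq> 0" using cd by auto
      have "(\<lambda>n. - Im (cauchy_transform \<nu> (Complex x (1 / real (Suc n))))) \<longlonglongrightarrow> - Im (1 / b x)"
        by (intro tendsto_intros cauchy_transform_vertical_limit bx)
      then show "(\<lambda>n. - Im (cauchy_transform \<nu> (Complex x (1 / real (Suc n))))) \<longlonglongrightarrow> pi * boundary_density x"
        by (simp add: boundary_density_def)
      fix n
      let ?z = "Complex x (1 / real (Suc n))"
      have "?z \<in> K" using x by (simp add: K_def in_cbox_complex_iff)
      moreover have "1 / Fext ?z = cauchy_transform \<nu> ?z" by (simp add: Fext_def F_transform_def)
      ultimately have "cmod (cauchy_transform \<nu> ?z) \<le> B" using B by metis
      then show "- Im (cauchy_transform \<nu> ?z) \<le> B"
        using abs_Im_le_cmod[of "cauchy_transform \<nu> ?z"] by linarith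
    qed
  qed simp
qed

text \<open>Both measures live on the complement of the zeros of \<open>b\<close>, agree on the
  intersection-stable family of compact intervals inside it, and are finite on a countable cover by
  such intervals.\<close>

lemma restrict_eq_density:
  "density \<nu> (indicator {x. b x \<noteq> 0}) = density lborel (\<lambda>x. ennreal (boundary_density x))"
proof -
  let ?U = "{x. b x \<noteq> 0}"
  have fin: "finite {x. b x = 0}" by (rule finite_F_boundary_zero)
  have U: "open ?U"
    using finite_imp_closed[OF fin] by (simp add: closed_def Collect_neg_eq)
  then have Ub[measurable]: "?U \<in> sets borel" by auto
  have fm[measurable]: "boundary_density \<in> borel_measurable borel" by (rule boundary_density_measurable)
  obtain A where A: "countable A" "A \<noteq> {}" "A \<subseteq> {{c..d} | c d. {c..d} \<subseteq> ?U}" "\<Union>A = ?U"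
    using sigma_sets_Icc_subset(2)[OF U] by blast
  have emb: "emeasure (density \<nu> (indicator ?U)) {c..d} = emeasure \<nu> {c..d}" if "{c..d} \<subseteq> ?U" for c d
  proof -
    have "emeasure (density \<nu> (indicator ?U)) {c..d} = (\<integral>\<^sup>+x. indicator ?U x * indicator {c..d} x \<partial>\<nu>)"
      by (subst emeasure_density) auto
    also have "\<dots> = (\<integral>\<^sup>+x. indicator {c..d} x \<partial>\<nu>)"
      using that by (intro nn_integral_cong) (auto simp: indicator_def)
    finally show ?thesis by simp
  qed
  show ?thesis
  proof (rule measure_eqI_restrict_generator[OF _ _ _ _ _ _ _ _ _ A])
    show "Int_stable {{c..d} | c d. {c..d} \<subseteq> ?U}"
    proof (rule Int_stableI)
      fix X Y assume "X \<in> {{c..d} | c d. {c..d} \<subseteq> ?U}" "Y \<in> {{c..d} | c d. {c..d} \<subseteq> ?U}"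
      then obtain c d c' d' where "X = {c..d}" "Y = {c'..d'}" "{c..d} \<subseteq> ?U" by blast
      then have "X \<inter> Y = {max c c'..min d d'}" "X \<inter> Y \<subseteq> ?U" by auto
      then show "X \<inter> Y \<in> {{c..d} | c d. {c..d} \<subseteq> ?U}" by (metis (mono_tags, lifting) mem_Collect_eq)
    qed
    show "{{c..d} | c d. {c..d} \<subseteq> ?U} \<subseteq> Pow ?U" by blast
    show "emeasure (density \<nu> (indicator ?U)) X = emeasure (density lborel (\<lambda>x. ennreal (boundary_density x))) X"
      if X: "X \<in> {{c..d} | c d. {c..d} \<subseteq> ?U}" for X
    proof -
      obtain c d where cd: "X = {c..d}" "{c..d} \<subseteq> ?U" using X by blast
      then show ?thesis using emb[OF cd(2)] emeasure_Icc[OF cd(2)] by (simp add: emeasure_density)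
    qed
    show "sets (density \<nu> (indicator ?U)) = sets (density lborel (\<lambda>x. ennreal (boundary_density x)))" by simp
    show "?U \<in> sets (density \<nu> (indicator ?U))" using Ub by simp
    show "sets (restrict_space (density \<nu> (indicator ?U)) ?U) = sigma_sets ?U {{c..d} | c d. {c..d} \<subseteq> ?U}"
      using sigma_sets_Icc_subset(1)[OF U] sets_restrict_space_cong[of "density \<nu> (indicator ?U)" borel] by simp
    show "sets (restrict_space (density lborel (\<lambda>x. ennreal (boundary_density x))) ?U) = sigma_sets ?U {{c..d} | c d. {c..d} \<subseteq> ?U}"
      using sigma_sets_Icc_subset(1)[OF U] sets_restrict_space_cong[of "density lborel (\<lambda>x. ennreal (boundary_density x))" borel] by simp
    show "AE x in density \<nu> (indicator ?U). x \<in> ?U"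
      by (subst AE_density) (auto simp: indicator_def)
    show "AE x in density lborel (\<lambda>x. ennreal (boundary_density x)). x \<in> ?U"
      by (subst AE_density, measurable) (auto simp: boundary_density_def)
    show "emeasure (density \<nu> (indicator ?U)) X \<noteq> \<infinity>" if X: "X \<in> A" for X
    proof -
      obtain c d where "X = {c..d}" "{c..d} \<subseteq> ?U" using X A(3) by blast
      then show ?thesis using emb by simp
    qed
  qed
qed

text \<open>The atoms of \<nu> are among the zeros of \<open>b\<close>. The other zeros form a
  finite \<nu>-null set, so removing the atoms or all zeros gives the same measure.\<close>

lemma nonatomic_part_eq_density: "nonatomic_part \<nu> = density lborel (\<lambda>x. ennreal (boundary_density x))"
proof -
  have fin: "finite {x. b x = 0}" by (rule finite_F_boundary_zero)
  have fin2: "finite (atoms \<nu>)" by (rule finite_subset[OF atoms_subset fin])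
  have sets: "{x. b x \<noteq> 0} \<in> sets borel" "- atoms \<nu> \<in> sets borel"
    using borel_closed[OF finite_imp_closed[OF fin]] borel_closed[OF finite_imp_closed[OF fin2]]
    by (auto simp: Collect_neg_eq)
  have "AE x in \<nu>. \<forall>a\<in>{x. b x = 0} - atoms \<nu>. x \<noteq> a"
  proof (rule AE_finite_allI)
    fix a assume "a \<in> {x. b x = 0} - atoms \<nu>"
    then have "measure \<nu> {a} = 0" by (auto simp: atoms_def not_less measure_le_0_iff)
    then have "{a} \<in> null_sets \<nu>" by (simp add: null_sets_def nu.emeasure_eq_measure)
    then show "AE x in \<nu>. x \<noteq> a" using AE_not_in by force
  qed (use fin in auto)
  then have "AE x in \<nu>. (indicator (- atoms \<nu>) x :: ennreal) = indicator {x. b x \<noteq> 0} x"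
    by eventually_elim (use atoms_subset in \<open>auto simp: indicator_def\<close>)
  then have "density \<nu> (indicator (- atoms \<nu>)) = density \<nu> (indicator {x. b x \<noteq> 0})"
    using sets by (intro density_cong) (auto intro: borel_measurable_indicator)
  then show ?thesis unfolding nonatomic_part_def restrict_eq_density .
qed

text \<open>A nonzero density puts the boundary value of \<open>om\<close> in the open half plane,
  where \<open>om\<close> and hence \<open>F_transform \<nu>\<close> continue holomorphically across
  \<open>x\<close>. The continuation \<open>K\<close> restricts to \<open>b\<close> on the
  axis.\<close>

lemma boundary_density_analytic:
  assumes "boundary_density x \<noteq> 0" shows "real_analytic_at boundary_density x"
proof -
  have "Im (b x) \<noteq> 0" using assms by (auto simp: boundary_density_altdef)
  then have Im: "0 < Im (b x)" using Im_F_boundary_nonneg[of x] by simp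
  then have b0: "b x \<noteq> 0" by auto
  have "(x + (t - 1) * b x) / t \<in> upper_half_plane"
    using Im t by (simp add: upper_half_plane_def)
  then obtain k r where r: "0 < r" and k: "k holomorphic_on ball (of_real x) r"
    and omk: "\<And>z. z \<in> ball (of_real x) r \<inter> upper_half_plane \<Longrightarrow> om z = k z"
    using \<omega>_local_extension[OF om_limit _ om_cluster] by metis
  define K where "K z = (t * k z - z) / (t - 1)" for z
  have K: "K holomorphic_on ball (of_real x) r"
    unfolding K_def using t by (intro holomorphic_intros k) auto
  have FK: "F_transform \<nu> z = K z" if "z \<in> ball (of_real x) r \<inter> upper_half_plane" for z
    using omk[OF that] t unfolding K_def by (auto simp: field_simps)
  have contK: "isCont K z" if "z \<in> ball (of_real x) r" for z
    using holomorphic_on_imp_continuous_on[OF K] that by (simp add: continuous_on_eq_continuous_at)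
  have bK: "b y = K (of_real y)" if y: "\<bar>y - x\<bar> < r" for y
  proof -
    have yb: "of_real y \<in> ball (complex_of_real x) r"
      using y by (simp add: dist_norm abs_minus_commute flip: of_real_diff)
    have "(K \<longlongrightarrow> K (of_real y)) (at (of_real y) within upper_half_plane)"
      using contK[OF yb] unfolding isCont_def by (rule tendsto_within_subset) simp
    moreover have "eventually (\<lambda>z. K z = F_transform \<nu> z) (at (of_real y) within upper_half_plane)"
      using FK yb unfolding eventually_at_topological by (intro exI[of _ "ball (of_real x) r"]) auto
    ultimately have "(F_transform \<nu> \<longlongrightarrow> K (of_real y)) (at (of_real y) within upper_half_plane)"
      by (rule Lim_transform_eventually)
    then show ?thesis
      by (rule tendsto_unique[OF at_within_upper_half_plane_nontrivial F_limit])
  qed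
  have "K (of_real x) \<noteq> 0" using bK[of x] b0 r by simp
  then obtain e where e: "0 < e" "\<And>z. dist (of_real x) z < e \<Longrightarrow> K z \<noteq> 0"
    using continuous_at_avoid[OF contK[of "of_real x"], of 0] r by auto
  define s where "s = min r e"
  have s: "0 < s" "s \<le> r" "s \<le> e" using r e by (auto simp: s_def)
  have hol: "(\<lambda>z. 1 / K z) holomorphic_on ball (of_real x) s"
    using e(2) s by (intro holomorphic_intros holomorphic_on_subset[OF K]) auto
  \<comment> \<open>Taylor coefficients of \<open>1 / K\<close> at \<open>x\<close>. On the axis the
    powers of \<open>y - x\<close> are real, so taking imaginary parts acts on the coefficients
    alone.\<close>
  define a where "a n = (deriv ^^ n) (\<lambda>z. 1 / K z) (of_real x) / fact n" for n
  have "(\<lambda>n. - (Im (a n) / pi) * (y - x) ^ n) sums boundary_density y" if y: "\<bar>y - x\<bar> < s" for y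
  proof -
    have "of_real y \<in> ball (complex_of_real x) s"
      using y by (simp add: dist_norm abs_minus_commute flip: of_real_diff)
    from holomorphic_power_series[OF hol this]
    have "(\<lambda>n. a n * of_real ((y - x) ^ n)) sums (1 / K (of_real y))" by (simp add: a_def)
    then have "(\<lambda>n. Im (a n * of_real ((y - x) ^ n))) sums Im (1 / K (of_real y))" by (rule sums_Im)
    then have "(\<lambda>n. (- 1 / pi) * (Im (a n) * (y - x) ^ n)) sums ((- 1 / pi) * Im (1 / K (of_real y)))"
      by (intro sums_mult) simp
    moreover have "(- 1 / pi) * Im (1 / K (of_real y)) = boundary_density y"
      using bK[of y] y s by (simp add: boundary_density_def)
    ultimately show ?thesis by simp
  qed
  with s(1) show ?thesis
    unfolding real_analytic_at_def
    by (intro exI[of _ "\<lambda>n. - (Im (a n) / pi)"] exI[of _ s] conjI allI impI)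
qed

end

text \<open>The single representative \<open>boundary_density\<close> witnesses both regularity
  claims, so continuity and analyticity concern the same version of the density.\<close>

theorem theorem2p3:
  fixes \<mu> \<nu> :: "real measure" and t :: real
  assumes "real_distribution \<mu>"
    and "t > 1"
    and "free_convolution_power \<mu> t \<nu>"
  shows "(\<forall>x. F_boundary \<nu> x = 0 \<longleftrightarrow>
            x / t \<in> atoms \<mu> \<and> measure \<mu> {x / t} \<ge> (t - 1) / t) \<and>
         (\<forall>x. measure \<mu> {x / t} > (t - 1) / t \<longrightarrow>
            x \<in> atoms \<nu> \<and> measure \<nu> {x} = t * measure \<mu> {x / t} - (t - 1)) \<and>
         absolutely_continuous lborel (nonatomic_part \<nu>) \<and>
         finite {x. F_boundary \<nu> x = 0} \<and>
         (\<exists>f :: real \<Rightarrow> real.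
            f \<in> borel_measurable borel \<and> (\<forall>x. 0 \<le> f x) \<and>
            nonatomic_part \<nu> = density lborel (\<lambda>x. ennreal (f x)) \<and>
            (\<forall>x. F_boundary \<nu> x \<noteq> 0 \<longrightarrow> isCont f x) \<and>
            (\<forall>x. f x \<noteq> 0 \<longrightarrow> real_analytic_at f x))"
proof -
  interpret free_power \<mu> \<nu> t
    unfolding free_power_def free_power_axioms_def
    using assms free_convolution_power_subordination[OF assms] by (simp add: free_convolution_power_def)
  have atom: "x \<in> atoms \<nu> \<and> measure \<nu> {x} = t * measure \<mu> {x / t} - (t - 1)"
    if m: "(t - 1) / t < measure \<mu> {x / t}" for x
  proof -
    have "t - 1 < t * measure \<mu> {x / t}" using m t by (simp add: field_simps)
    then show ?thesis using measure_atom[OF m] by (simp add: atoms_def)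
  qed
  have ac: "absolutely_continuous lborel (nonatomic_part \<nu>)"
    unfolding nonatomic_part_eq_density using boundary_density_measurable by (intro absolutely_continuousI_density) auto
  show ?thesis
    using F_boundary_zero_iff atom ac finite_F_boundary_zero boundary_density_measurable boundary_density_nonneg
      nonatomic_part_eq_density isCont_boundary_density boundary_density_analytic
    by blast
qed

end
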